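(* Let $k$ be a field. Let $f,g : X\to Z$ be continuous maps between connected topological spaces. Let $H : X\times[0,1]\to Z$ be a homotopy between $f$ and $g$. For a fixed point $\tilde{x}\in X$ consider the path $\gamma : [0,1]\to Z$ from $f(\tilde{x})$ to $g(\tilde{x})$ defined by $\gamma(t)=H(\tilde{x},t)$. Then the following diagram of $k$-groups commutes: $$\begin{array}{ccc} \pi_k(X,\tilde{x}) & \xrightarrow{\ f_*\ } & \pi_k(Z,f(\tilde{x})) \\ \| & & \ \downarrow{\scriptstyle \gamma_k} \\ \pi_k(X,\tilde{x}) & \xrightarrow{\ g_*\ } & \pi_k(Z,g(\tilde{x})) \end{array}$$ i.e. $\gamma_k\circ f_*=g_*$, where $\gamma_k$ is the isomorphism defined by the path $\gamma$.
   Context: A $k$-group is an affine group scheme over $k$. $\mathbf{Loc}_k(X)$ is the category of local systems of finite-dimensional $k$-vector spaces on $X$. For $X$ connected and $x\in X$ it is a neutral Tannakian category with fibre functor $\omega_x(\mathcal{E})=\mathcal{E}_x$, and $\pi_k(X,x)=\underline{\mathrm{Aut}}^\otimes(\omega_x)$ is its Tannakian dual. A continuous map $f:X\to Z$ of connected spaces induces $f_*:\pi_k(X,x)\to\pi_k(Z,f(x))$ via the tensor functor $f^{-1}:\mathbf{Loc}_k(Z)\to\mathbf{Loc}_k(X)$ and $\omega_x\circ f^{-1}=\omega_{f(x)}$. Path isomorphism: let $Z$ be connected and $\gamma:[0,1]\to Z$ a continuous path with $\gamma(0)=z_0$, $\gamma(1)=z_1$. For $\mathcal{E}$ in $\mathbf{Loc}_k(Z)$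 the sheaf $\gamma^{-1}\mathcal{E}$ is constant on $[0,1]$, so evaluation at the end points gives isomorphisms $\mathcal{E}_{z_0}\xleftarrow{\sim}\Gamma([0,1],\gamma^{-1}\mathcal{E})\xrightarrow{\sim}\mathcal{E}_{z_1}$; their composition defines an isomorphism of tensor functors $\omega_\gamma:\omega_{z_0}\to\omega_{z_1}$. Then $\gamma_k:\pi_k(Z,z_0)\xrightarrow{\sim}\pi_k(Z,z_1)$ is the isomorphism of $k$-groups $\alpha\mapsto\omega_\gamma\circ\alpha\circ\omega_\gamma^{-1}$. *)

theory Defs
  imports "HOL-Analysis.Analysis" "HOL-Algebra.Module"
begin

text \<open>
  Vector spaces over the field \<open>K\<close> are modules in the sense of HOL-Algebra; the ring
  multiplication and unit that the record type \<open>module\<close> inherits play no role for them and are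
  left \<open>undefined\<close>.
\<close>

definition linear_maps ::
  "('k, 'c) ring_scheme \<Rightarrow> ('k, 'v) module \<Rightarrow> ('k, 'w) module \<Rightarrow> ('v \<Rightarrow> 'w) set" where
  "linear_maps K V W = {h \<in> carrier V \<rightarrow> carrier W.
     (\<forall>v\<in>carrier V. \<forall>v'\<in>carrier V. h (v \<oplus>\<^bsub>V\<^esub> v') = h v \<oplus>\<^bsub>W\<^esub> h v') \<and>
     (\<forall>c\<in>carrier K. \<forall>v\<in>carrier V. h (c \<odot>\<^bsub>V\<^esub> v) = c \<odot>\<^bsub>W\<^esub> h v)}"

definition self_module :: "'k ring \<Rightarrow> ('k, 'k) module" where
  "self_module K = \<lparr>carrier = carrier K, mult = undefined, one = undefined,
     zero = \<zero>\<^bsub>K\<^esub>, add = add K, smult = mult K\<rparr>"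

definition pointwise_module ::
  "'i set \<Rightarrow> ('i \<Rightarrow> ('k, 'v) module) \<Rightarrow> ('i \<Rightarrow> 'v) set \<Rightarrow> ('k, 'i \<Rightarrow> 'v) module" where
  "pointwise_module I M A = \<lparr>carrier = A, mult = undefined, one = undefined,
     zero = (\<lambda>i\<in>I. \<zero>\<^bsub>M i\<^esub>),
     add = (\<lambda>s t. \<lambda>i\<in>I. s i \<oplus>\<^bsub>M i\<^esub> t i),
     smult = (\<lambda>c s. \<lambda>i\<in>I. c \<odot>\<^bsub>M i\<^esub> s i)\<rparr>"

definition coord_space :: "'k ring \<Rightarrow> nat \<Rightarrow> ('k, nat \<Rightarrow> 'k) module" where
  "coord_space K n =
     pointwise_module {..<n} (\<lambda>_. self_module K) ({..<n} \<rightarrow>\<^sub>E carrier K)"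


section \<open>Tensor products and base change\<close>

text \<open>
  An element of the tensor product is a formal sum of pairs, written as a list, modulo the
  congruence generated by commutativity and the bilinear relations.  Coefficients are not needed
  because they can be moved into either factor.
\<close>

inductive tensor_eq ::
  "('k, 'c) ring_scheme \<Rightarrow> ('k, 'v) module \<Rightarrow> ('k, 'w) module \<Rightarrow>
   ('v \<times> 'w) list \<Rightarrow> ('v \<times> 'w) list \<Rightarrow> bool"
  for K V W where
  refl: "xs \<in> lists (carrier V \<times> carrier W) \<Longrightarrow> tensor_eq K V W xs xs"
| sym: "tensor_eq K V W xs ys \<Longrightarrow> tensor_eq K V W ys xs"
| trans: "tensor_eq K V W xs ys \<Longrightarrow> tensor_eq K V W ys zs \<Longrightarrow> tensor_eq K V W xs zs"
| append: "tensor_eq K V W xs xs' \<Longrightarrow> tensor_eq K V W ys ys' \<Longrightarrow>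
    tensor_eq K V W (xs @ ys) (xs' @ ys')"
| commute: "xs \<in> lists (carrier V \<times> carrier W) \<Longrightarrow> ys \<in> lists (carrier V \<times> carrier W) \<Longrightarrow>
    tensor_eq K V W (xs @ ys) (ys @ xs)"
| zero_left: "w \<in> carrier W \<Longrightarrow> tensor_eq K V W [(\<zero>\<^bsub>V\<^esub>, w)] []"
| add_left: "v \<in> carrier V \<Longrightarrow> v' \<in> carrier V \<Longrightarrow> w \<in> carrier W \<Longrightarrow>
    tensor_eq K V W [(v \<oplus>\<^bsub>V\<^esub> v', w)] [(v, w), (v', w)]"
| add_right: "v \<in> carrier V \<Longrightarrow> w \<in> carrier W \<Longrightarrow> w' \<in> carrier W \<Longrightarrow>
    tensor_eq K V W [(v, w \<oplus>\<^bsub>W\<^esub> w')] [(v, w), (v, w')]"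
| balanced: "c \<in> carrier K \<Longrightarrow> v \<in> carrier V \<Longrightarrow> w \<in> carrier W \<Longrightarrow>
    tensor_eq K V W [(c \<odot>\<^bsub>V\<^esub> v, w)] [(v, c \<odot>\<^bsub>W\<^esub> w)]"

definition tensor_class ::
  "('k, 'c) ring_scheme \<Rightarrow> ('k, 'v) module \<Rightarrow> ('k, 'w) module \<Rightarrow>
   ('v \<times> 'w) list \<Rightarrow> ('v \<times> 'w) list set" where
  "tensor_class K V W xs = {ys. tensor_eq K V W xs ys}"

text \<open>
  Operations on equivalence classes (here, and for germs below) are written as the union, over all
  representatives, of the resulting classes; these classes all coincide, as for \<open>set_mult\<close> on cosets.
\<close>

definition tensor ::
  "('k, 'c) ring_scheme \<Rightarrow> ('k, 'v) module \<Rightarrow> ('k, 'w) module \<Rightarrow>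
   ('k, ('v \<times> 'w) list set) module" where
  "tensor K V W = \<lparr>carrier = tensor_class K V W ` lists (carrier V \<times> carrier W),
     mult = undefined, one = undefined,
     zero = tensor_class K V W [],
     add = (\<lambda>A B. \<Union>xs\<in>A. \<Union>ys\<in>B. tensor_class K V W (xs @ ys)),
     smult = (\<lambda>c A. \<Union>xs\<in>A. tensor_class K V W (map (\<lambda>(v, w). (c \<odot>\<^bsub>V\<^esub> v, w)) xs))\<rparr>"

definition pure_tensor ::
  "('k, 'c) ring_scheme \<Rightarrow> ('k, 'v) module \<Rightarrow> ('k, 'w) module \<Rightarrow>
   'v \<Rightarrow> 'w \<Rightarrow> ('v \<times> 'w) list set" where
  "pure_tensor K V W v w = tensor_class K V W [(v, w)]"

text \<open>\<open>tensor_map K V' W' f g\<close> is the map induced by \<open>f\<close> and \<open>g\<close> into the tensor product of \<open>V'\<close> and \<open>W'\<close>.\<close>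

definition tensor_map ::
  "('k, 'c) ring_scheme \<Rightarrow> ('k, 'v2) module \<Rightarrow> ('k, 'w2) module \<Rightarrow> ('v \<Rightarrow> 'v2) \<Rightarrow> ('w \<Rightarrow> 'w2) \<Rightarrow>
   ('v \<times> 'w) list set \<Rightarrow> ('v2 \<times> 'w2) list set" where
  "tensor_map K V' W' f g A = (\<Union>xs\<in>A. tensor_class K V' W' (map (map_prod f g) xs))"

text \<open>The tensor product of \<open>V\<close> with a \<open>K\<close>-algebra \<open>R\<close>, regarded as an \<open>R\<close>-module.\<close>

definition base_change ::
  "('k, 'c) ring_scheme \<Rightarrow> ('k, 'r) module \<Rightarrow> ('k, 'v) module \<Rightarrow>
   ('r, ('v \<times> 'r) list set) module" where
  "base_change K R V = \<lparr>carrier = carrier (tensor K V R), mult = undefined, one = undefined,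
     zero = zero (tensor K V R), add = add (tensor K V R),
     smult = (\<lambda>r A. \<Union>xs\<in>A. tensor_class K V R (map (\<lambda>(v, r'). (v, r \<otimes>\<^bsub>R\<^esub> r')) xs))\<rparr>"

definition base_change_map ::
  "('k, 'c) ring_scheme \<Rightarrow> ('k, 'r) module \<Rightarrow> ('k, 'w) module \<Rightarrow> ('v \<Rightarrow> 'w) \<Rightarrow>
   ('v \<times> 'r) list set \<Rightarrow> ('w \<times> 'r) list set" where
  "base_change_map K R W h = tensor_map K W R h (\<lambda>r. r)"

text \<open>The \<open>R\<close>-bilinear extension of a \<open>K\<close>-bilinear map \<open>b\<close> with values in \<open>T\<close>.\<close>

definition base_change_bilinear ::
  "('k, 'c) ring_scheme \<Rightarrow> ('k, 'r) module \<Rightarrow> ('k, 't) module \<Rightarrow> ('v \<Rightarrow> 'w \<Rightarrow> 't) \<Rightarrow>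
   ('v \<times> 'r) list set \<Rightarrow> ('w \<times> 'r) list set \<Rightarrow> ('t \<times> 'r) list set" where
  "base_change_bilinear K R T b A B = (\<Union>xs\<in>A. \<Union>ys\<in>B.
     tensor_class K T R
       (concat (map (\<lambda>(v, r). map (\<lambda>(w, r'). (b v w, r \<otimes>\<^bsub>R\<^esub> r')) ys) xs)))"


section \<open>Sheaves of vector spaces\<close>

text \<open>
  \<open>sec F U\<close> is the space of sections over \<open>U\<close> and \<open>res F U V\<close> the restriction from \<open>U\<close> to \<open>V\<close>.
  Only their values at open sets matter.  The type \<open>'s\<close> of sections plays the role of a universe.
\<close>

record ('k, 'x, 's) presheaf =
  sec :: "'x set \<Rightarrow> ('k, 's) module"
  res :: "'x set \<Rightarrow> 'x set \<Rightarrow> 's \<Rightarrow> 's"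

definition is_presheaf :: "'k ring \<Rightarrow> 'x topology \<Rightarrow> ('k, 'x, 's) presheaf \<Rightarrow> bool" where
  "is_presheaf K X F \<longleftrightarrow>
     (\<forall>U. openin X U \<longrightarrow> Module.module K (sec F U)) \<and>
     (\<forall>U V. openin X U \<and> openin X V \<and> V \<subseteq> U \<longrightarrow>
        res F U V \<in> linear_maps K (sec F U) (sec F V)) \<and>
     (\<forall>U. openin X U \<longrightarrow> (\<forall>s\<in>carrier (sec F U). res F U U s = s)) \<and>
     (\<forall>U V W. openin X U \<and> openin X V \<and> openin X W \<and> W \<subseteq> V \<and> V \<subseteq> U \<longrightarrow>
        (\<forall>s\<in>carrier (sec F U). res F V W (res F U V s) = res F U W s))"

definition is_sheaf :: "'k ring \<Rightarrow> 'x topology \<Rightarrow> ('k, 'x, 's) presheaf \<Rightarrow> bool" where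
  "is_sheaf K X F \<longleftrightarrow> is_presheaf K X F \<and>
     (\<forall>\<U> \<sigma>. (\<forall>U\<in>\<U>. openin X U \<and> \<sigma> U \<in> carrier (sec F U)) \<and>
        (\<forall>U\<in>\<U>. \<forall>V\<in>\<U>. res F U (U \<inter> V) (\<sigma> U) = res F V (U \<inter> V) (\<sigma> V)) \<longrightarrow>
        (\<exists>!s. s \<in> carrier (sec F (\<Union>\<U>)) \<and> (\<forall>U\<in>\<U>. res F (\<Union>\<U>) U s = \<sigma> U)))"

definition sheaf_hom ::
  "'k ring \<Rightarrow> 'x topology \<Rightarrow> ('k, 'x, 's) presheaf \<Rightarrow> ('k, 'x, 't) presheaf \<Rightarrow>
   ('x set \<Rightarrow> 's \<Rightarrow> 't) \<Rightarrow> bool" where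
  "sheaf_hom K X F G \<phi> \<longleftrightarrow>
     (\<forall>U. openin X U \<longrightarrow> \<phi> U \<in> linear_maps K (sec F U) (sec G U)) \<and>
     (\<forall>U V. openin X U \<and> openin X V \<and> V \<subseteq> U \<longrightarrow>
        (\<forall>s\<in>carrier (sec F U). \<phi> V (res F U V s) = res G U V (\<phi> U s)))"

definition sheaf_iso ::
  "'k ring \<Rightarrow> 'x topology \<Rightarrow> ('k, 'x, 's) presheaf \<Rightarrow> ('k, 'x, 't) presheaf \<Rightarrow>
   ('x set \<Rightarrow> 's \<Rightarrow> 't) \<Rightarrow> bool" where
  "sheaf_iso K X F G \<phi> \<longleftrightarrow> sheaf_hom K X F G \<phi> \<and>
     (\<forall>U. openin X U \<longrightarrow> bij_betw (\<phi> U) (carrier (sec F U)) (carrier (sec G U)))"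

definition const_sheaf :: "'x topology \<Rightarrow> ('k, 'v) module \<Rightarrow> ('k, 'x, 'x \<Rightarrow> 'v) presheaf" where
  "const_sheaf X M = \<lparr>
     sec = (\<lambda>U. pointwise_module U (\<lambda>_. M)
       {s \<in> U \<rightarrow>\<^sub>E carrier M.
          \<forall>x\<in>U. \<exists>W. openin X W \<and> x \<in> W \<and> W \<subseteq> U \<and> (\<forall>y\<in>W. s y = s x)}),
     res = (\<lambda>U V s. restrict s V)\<rparr>"

text \<open>
  A local system of finite-dimensional vector spaces is a sheaf that is locally isomorphic to a
  constant sheaf with value \<open>K\<^sup>n\<close>.  The restriction of \<open>F\<close> to an open subset \<open>V\<close> is \<open>F\<close> itself,
  considered on \<open>subtopology X V\<close>.
\<close>

definition local_system :: "'k ring \<Rightarrow> 'x topology \<Rightarrow> ('k, 'x, 's) presheaf \<Rightarrow> bool" where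
  "local_system K X F \<longleftrightarrow> is_sheaf K X F \<and>
     (\<forall>x\<in>topspace X. \<exists>V n \<phi>. openin X V \<and> x \<in> V \<and>
        sheaf_iso K (subtopology X V) F (const_sheaf (subtopology X V) (coord_space K n)) \<phi>)"

definition germ ::
  "'x topology \<Rightarrow> ('k, 'x, 's) presheaf \<Rightarrow> 'x \<Rightarrow> 'x set \<Rightarrow> 's \<Rightarrow> ('x set \<times> 's) set" where
  "germ X F x U s = {(V, t). openin X V \<and> x \<in> V \<and> t \<in> carrier (sec F V) \<and>
     (\<exists>W. openin X W \<and> x \<in> W \<and> W \<subseteq> U \<inter> V \<and> res F U W s = res F V W t)}"

definition stalk ::
  "'x topology \<Rightarrow> ('k, 'x, 's) presheaf \<Rightarrow> 'x \<Rightarrow> ('k, ('x set \<times> 's) set) module" where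
  "stalk X F x = \<lparr>
     carrier = {germ X F x U s | U s. openin X U \<and> x \<in> U \<and> s \<in> carrier (sec F U)},
     mult = undefined, one = undefined,
     zero = germ X F x (topspace X) \<zero>\<^bsub>sec F (topspace X)\<^esub>,
     add = (\<lambda>a b. \<Union>(U, s)\<in>a. \<Union>(V, t)\<in>b.
       germ X F x (U \<inter> V) (res F U (U \<inter> V) s \<oplus>\<^bsub>sec F (U \<inter> V)\<^esub> res F V (U \<inter> V) t)),
     smult = (\<lambda>c a. \<Union>(U, s)\<in>a. germ X F x U (c \<odot>\<^bsub>sec F U\<^esub> s))\<rparr>"

definition stalk_map ::
  "'x topology \<Rightarrow> ('k, 'x, 't) presheaf \<Rightarrow> 'x \<Rightarrow> ('x set \<Rightarrow> 's \<Rightarrow> 't) \<Rightarrow>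
   ('x set \<times> 's) set \<Rightarrow> ('x set \<times> 't) set" where
  "stalk_map X G x \<phi> a = (\<Union>(U, s)\<in>a. germ X G x U (\<phi> U s))"

text \<open>
  Sections of the inverse image of \<open>F\<close> under \<open>f\<close> over \<open>U\<close> are the families of germs of \<open>F\<close> at the
  points \<open>f x\<close>, for \<open>x\<close> in \<open>U\<close>, that are locally induced by sections of \<open>F\<close>.  For a presheaf \<open>F\<close>
  and the identity map this is the sheafification of \<open>F\<close>.
\<close>

definition inv_image ::
  "'x topology \<Rightarrow> 'z topology \<Rightarrow> ('x \<Rightarrow> 'z) \<Rightarrow> ('k, 'z, 's) presheaf \<Rightarrow>
   ('k, 'x, 'x \<Rightarrow> ('z set \<times> 's) set) presheaf" where
  "inv_image X Z f F = \<lparr>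
     sec = (\<lambda>U. pointwise_module U (\<lambda>x. stalk Z F (f x))
       {s \<in> \<Pi>\<^sub>E x\<in>U. carrier (stalk Z F (f x)).
          \<forall>x\<in>U. \<exists>W V t. openin X W \<and> x \<in> W \<and> W \<subseteq> U \<and> openin Z V \<and> f ` W \<subseteq> V \<and>
            t \<in> carrier (sec F V) \<and> (\<forall>y\<in>W. s y = germ Z F (f y) V t)}),
     res = (\<lambda>U V s. restrict s V)\<rparr>"

text \<open>
  The canonical isomorphism from the stalk at \<open>x\<close> of the inverse image of \<open>F\<close> under \<open>f\<close> to the stalk
  of \<open>F\<close> at \<open>f x\<close>: the germ of a section \<open>s\<close> is sent to \<open>s x\<close>.
\<close>

definition inv_image_stalk :: "'x \<Rightarrow> ('x set \<times> ('x \<Rightarrow> 'a)) set \<Rightarrow> 'a" where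
  "inv_image_stalk x a = the_elem ((\<lambda>(U, s). s x) ` a)"

definition tensor_presheaf ::
  "'k ring \<Rightarrow> ('k, 'x, 's) presheaf \<Rightarrow> ('k, 'x, 't) presheaf \<Rightarrow>
   ('k, 'x, ('s \<times> 't) list set) presheaf" where
  "tensor_presheaf K E F = \<lparr>
     sec = (\<lambda>U. tensor K (sec E U) (sec F U)),
     res = (\<lambda>U V. tensor_map K (sec E V) (sec F V) (res E U V) (res F U V))\<rparr>"

definition tensor_sheaf ::
  "'k ring \<Rightarrow> 'x topology \<Rightarrow> ('k, 'x, 's) presheaf \<Rightarrow> ('k, 'x, 't) presheaf \<Rightarrow>
   ('k, 'x, 'x \<Rightarrow> ('x set \<times> ('s \<times> 't) list set) set) presheaf" where
  "tensor_sheaf K X E F = inv_image X X (\<lambda>x. x) (tensor_presheaf K E F)"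

text \<open>
  The canonical bilinear map from the stalks at \<open>x\<close> of \<open>E\<close> and \<open>F\<close> to the stalk of their tensor
  product, which identifies the latter with the tensor product of the two stalks.
\<close>

definition tensor_germ ::
  "'k ring \<Rightarrow> 'x topology \<Rightarrow> ('k, 'x, 's) presheaf \<Rightarrow> ('k, 'x, 't) presheaf \<Rightarrow> 'x \<Rightarrow>
   ('x set \<times> 's) set \<Rightarrow> ('x set \<times> 't) set \<Rightarrow>
   ('x set \<times> ('x \<Rightarrow> ('x set \<times> ('s \<times> 't) list set) set)) set" where
  "tensor_germ K X E F x a b = (\<Union>(U, s)\<in>a. \<Union>(V, t)\<in>b.
     germ X (tensor_sheaf K X E F) x (U \<inter> V)
       (\<lambda>y\<in>U \<inter> V. germ X (tensor_presheaf K E F) y (U \<inter> V)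
          (pure_tensor K (sec E (U \<inter> V)) (sec F (U \<inter> V))
             (res E U (U \<inter> V) s) (res F V (U \<inter> V) t))))"


section \<open>The Tannakian dual of the category of local systems\<close>

text \<open>
  \<open>fibre K R X x E\<close> is the base change to \<open>R\<close> of the value at \<open>E\<close> of the fibre functor of \<open>x\<close>.
\<close>

definition fibre ::
  "'k ring \<Rightarrow> ('k, 'r) module \<Rightarrow> 'x topology \<Rightarrow> 'x \<Rightarrow> ('k, 'x, 's) presheaf \<Rightarrow>
   ('r, (('x set \<times> 's) set \<times> 'r) list set) module" where
  "fibre K R X x E = base_change K R (stalk X E x)"

type_synonym ('k, 'x, 's, 'r) fibre_family =
  "('k, 'x, 's) presheaf \<Rightarrow>
   (('x set \<times> 's) set \<times> 'r) list set \<Rightarrow> (('x set \<times> 's) set \<times> 'r) list set"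

text \<open>
  The automorphisms of the tensor functor \<open>E \<mapsto> fibre K R X x E\<close>: families of \<open>R\<close>-linear automorphisms
  that are natural and compatible with tensor products and with the unit object.  The tensor product
  of \<open>E\<close> and \<open>F\<close> and the constant sheaf \<open>K\<close> have sections in types other than \<open>'s\<close>, so they enter
  through isomorphic copies \<open>T\<close> and \<open>I\<close> with sections in \<open>'s\<close>.
\<close>

definition tensor_automorphism ::
  "'k ring \<Rightarrow> ('k, 'r) module \<Rightarrow> 'x topology \<Rightarrow> 'x \<Rightarrow> ('k, 'x, 's, 'r) fibre_family \<Rightarrow> bool" where
  "tensor_automorphism K R X x \<alpha> \<longleftrightarrow>
     \<alpha> \<in> extensional {E. local_system K X E} \<and>
     (\<forall>E. local_system K X E \<longrightarrow>
        \<alpha> E \<in> extensional (carrier (fibre K R X x E)) \<and>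
        \<alpha> E \<in> linear_maps R (fibre K R X x E) (fibre K R X x E) \<and>
        bij_betw (\<alpha> E) (carrier (fibre K R X x E)) (carrier (fibre K R X x E))) \<and>
     (\<forall>E F \<phi>. local_system K X E \<and> local_system K X F \<and> sheaf_hom K X E F \<phi> \<longrightarrow>
        (\<forall>a\<in>carrier (fibre K R X x E).
           \<alpha> F (base_change_map K R (stalk X F x) (stalk_map X F x \<phi>) a) =
           base_change_map K R (stalk X F x) (stalk_map X F x \<phi>) (\<alpha> E a))) \<and>
     (\<forall>E F T \<tau>. local_system K X E \<and> local_system K X F \<and> local_system K X T \<and>
        sheaf_iso K X (tensor_sheaf K X E F) T \<tau> \<longrightarrow>
        (let b = base_change_bilinear K R (stalk X T x)
                   (\<lambda>e e'. stalk_map X T x \<tau> (tensor_germ K X E F x e e'))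
         in \<forall>a\<in>carrier (fibre K R X x E). \<forall>a'\<in>carrier (fibre K R X x F).
              \<alpha> T (b a a') = b (\<alpha> E a) (\<alpha> F a'))) \<and>
     (\<forall>I \<iota>. local_system K X I \<and> sheaf_iso K X (const_sheaf X (self_module K)) I \<iota> \<longrightarrow>
        (let u = pure_tensor K (stalk X I x) R
                   (germ X I x (topspace X) (\<iota> (topspace X) (\<lambda>y\<in>topspace X. \<one>\<^bsub>K\<^esub>))) \<one>\<^bsub>R\<^esub>
         in \<alpha> I u = u))"

text \<open>
  \<open>pi_k K R X x\<close> is the group of \<open>R\<close>-valued points of the \<open>K\<close>-group attached to \<open>X\<close> and \<open>x\<close>.  Affine group
  schemes over \<open>K\<close> are described by their functors of points on \<open>K\<close>-algebras, so a morphism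
  of \<open>K\<close>-groups is given by its maps on \<open>R\<close>-valued points for all \<open>R\<close>.
\<close>

definition pi_k ::
  "'k ring \<Rightarrow> ('k, 'r) module \<Rightarrow> 'x topology \<Rightarrow> 'x \<Rightarrow> ('k, 'x, 's, 'r) fibre_family monoid" where
  "pi_k K R X x = \<lparr>
     carrier = {\<alpha>. tensor_automorphism K R X x \<alpha>},
     mult = (\<lambda>\<alpha> \<beta>. \<lambda>E\<in>{E. local_system K X E}. \<lambda>a\<in>carrier (fibre K R X x E). \<alpha> E (\<beta> E a)),
     one = (\<lambda>E\<in>{E. local_system K X E}. \<lambda>a\<in>carrier (fibre K R X x E). a)\<rparr>"

text \<open>
  The map on \<open>R\<close>-valued points induced by \<open>f\<close>.  The stalk at \<open>f x\<close> of a local system on \<open>Z\<close> and the stalk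
  at \<open>x\<close> of its inverse image are identified along \<open>inv_image_stalk x\<close>.
\<close>

definition pi_k_map ::
  "'k ring \<Rightarrow> ('k, 'r) module \<Rightarrow> 'x topology \<Rightarrow> 'z topology \<Rightarrow> ('x \<Rightarrow> 'z) \<Rightarrow> 'x \<Rightarrow>
   ('k, 'x, 'x \<Rightarrow> ('z set \<times> 's) set, 'r) fibre_family \<Rightarrow> ('k, 'z, 's, 'r) fibre_family" where
  "pi_k_map K R X Z f x \<alpha> =
     (\<lambda>E\<in>{E. local_system K Z E}. \<lambda>a\<in>carrier (fibre K R Z (f x) E).
        let c = base_change_map K R (stalk Z E (f x)) (inv_image_stalk x)
        in c (\<alpha> (inv_image X Z f E)
                (inv_into (carrier (fibre K R X x (inv_image X Z f E))) c a)))"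

text \<open>
  The isomorphism from the stalk of \<open>E\<close> at \<open>\<gamma> 0\<close> to that at \<open>\<gamma> 1\<close>: extend an element to a global section
  of the inverse image of \<open>E\<close> on the unit interval and evaluate at the end point.
\<close>

definition path_transport ::
  "'z topology \<Rightarrow> (real \<Rightarrow> 'z) \<Rightarrow> ('k, 'z, 's) presheaf \<Rightarrow>
   ('z set \<times> 's) set \<Rightarrow> ('z set \<times> 's) set" where
  "path_transport Z \<gamma> E v =
     inv_into (carrier (sec (inv_image (top_of_set {0..1}) Z \<gamma> E) {0..1})) (\<lambda>s. s 0) v 1"

definition pi_k_path ::
  "'k ring \<Rightarrow> ('k, 'r) module \<Rightarrow> 'z topology \<Rightarrow> (real \<Rightarrow> 'z) \<Rightarrow>
   ('k, 'z, 's, 'r) fibre_family \<Rightarrow> ('k, 'z, 's, 'r) fibre_family" where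
  "pi_k_path K R Z \<gamma> \<alpha> =
     (\<lambda>E\<in>{E. local_system K Z E}. \<lambda>a\<in>carrier (fibre K R Z (\<gamma> 1) E).
        let w = base_change_map K R (stalk Z E (\<gamma> 1)) (path_transport Z \<gamma> E)
        in w (\<alpha> E (inv_into (carrier (fibre K R Z (\<gamma> 0) E)) w a)))"

end

theory Submission
  imports Defs
begin

text \<open>
  Let \<open>E\<close> be a local system on \<open>Z\<close>.  For each point \<open>y\<close> of \<open>X\<close> the path \<open>t \<mapsto> H (y, t)\<close> transports the stalk
  of \<open>E\<close> at \<open>f y\<close> to the stalk at \<open>g y\<close>.  The idea is that these maps vary continuously with \<open>y\<close>, so
  that together they form a morphism \<open>\<phi>\<close> from the inverse image of \<open>E\<close> under \<open>f\<close> to its inverse image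
  under \<open>g\<close>.  On the stalk at the base point, \<open>\<phi>\<close> is the transport along \<open>\<gamma>\<close>.  Both inverse images
  are local systems on \<open>X\<close>, hence an automorphism \<open>\<alpha>\<close> of the fibre functor is natural with respect to
  \<open>\<phi>\<close>, and this naturality square is exactly the asserted identity at \<open>E\<close>.

  All properties of local systems come from local frames (\<open>local_system_local_frame\<close>): near each
  point there is a finite-dimensional space of sections that represent every germ at every nearby
  point exactly once.  They give the local triviality of inverse images (\<open>local_system_inv_image\<close>) and the
  uniqueness of continuation of sections over connected spaces (\<open>inv_image_section_unique\<close>).
  Continuity of the transport in \<open>y\<close> is \<open>horizontal_continuation\<close>: the set of intervals along which
  transport can be carried out uniformly for all \<open>y\<close> near a given point is closed under concatenation and
  contains all sufficiently short intervals, so by compactness it contains the unit interval.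
  The rest is bookkeeping: the stalks, the comparison map from the stalk of an inverse image, and the
  base change to \<open>R\<close> are functorial, and the maps inverted in the definitions are invertible.
\<close>

section \<open>Modules, linear maps and base change\<close>

lemma linear_mapsD:
  assumes "h \<in> linear_maps K V W"
  shows "v \<in> carrier V \<Longrightarrow> h v \<in> carrier W"
    and "v \<in> carrier V \<Longrightarrow> v' \<in> carrier V \<Longrightarrow> h (v \<oplus>\<^bsub>V\<^esub> v') = h v \<oplus>\<^bsub>W\<^esub> h v'"
    and "c \<in> carrier K \<Longrightarrow> v \<in> carrier V \<Longrightarrow> h (c \<odot>\<^bsub>V\<^esub> v) = c \<odot>\<^bsub>W\<^esub> h v"
  using assms unfolding linear_maps_def by auto

lemma linear_mapsI:
  assumes "\<And>v. v \<in> carrier V \<Longrightarrow> h v \<in> carrier W"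
    and "\<And>v v'. v \<in> carrier V \<Longrightarrow> v' \<in> carrier V \<Longrightarrow> h (v \<oplus>\<^bsub>V\<^esub> v') = h v \<oplus>\<^bsub>W\<^esub> h v'"
    and "\<And>c v. c \<in> carrier K \<Longrightarrow> v \<in> carrier V \<Longrightarrow> h (c \<odot>\<^bsub>V\<^esub> v) = c \<odot>\<^bsub>W\<^esub> h v"
  shows "h \<in> linear_maps K V W"
  using assms unfolding linear_maps_def by auto

lemma module_closed:
  assumes "Module.module K M"
  shows "v \<in> carrier M \<Longrightarrow> w \<in> carrier M \<Longrightarrow> v \<oplus>\<^bsub>M\<^esub> w \<in> carrier M"
    and "c \<in> carrier K \<Longrightarrow> v \<in> carrier M \<Longrightarrow> c \<odot>\<^bsub>M\<^esub> v \<in> carrier M"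
    and "\<zero>\<^bsub>M\<^esub> \<in> carrier M"
proof -
  interpret Module.module K M by fact
  show "v \<in> carrier M \<Longrightarrow> w \<in> carrier M \<Longrightarrow> v \<oplus>\<^bsub>M\<^esub> w \<in> carrier M" by simp
  show "c \<in> carrier K \<Longrightarrow> v \<in> carrier M \<Longrightarrow> c \<odot>\<^bsub>M\<^esub> v \<in> carrier M" by simp
  show "\<zero>\<^bsub>M\<^esub> \<in> carrier M" by simp
qed

lemma linear_maps_zero:
  assumes "Module.module K V" "Module.module K W" "h \<in> linear_maps K V W"
  shows "h \<zero>\<^bsub>V\<^esub> = \<zero>\<^bsub>W\<^esub>"
proof -
  interpret V: Module.module K V by fact
  interpret W: Module.module K W by fact
  note h = linear_mapsD[OF assms(3)]
  have "h \<zero>\<^bsub>V\<^esub> \<oplus>\<^bsub>W\<^esub> h \<zero>\<^bsub>V\<^esub> = h \<zero>\<^bsub>V\<^esub>"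
    using h(2)[of "\<zero>\<^bsub>V\<^esub>" "\<zero>\<^bsub>V\<^esub>"] by simp
  then show ?thesis
    using h(1)[of "\<zero>\<^bsub>V\<^esub>"] by (simp add: W.add.l_cancel_one)
qed

lemma linear_maps_inv_into:
  assumes "Module.module K V" "h \<in> linear_maps K V W" "bij_betw h (carrier V) (carrier W)"
  shows "inv_into (carrier V) h \<in> linear_maps K W V"
proof (rule linear_mapsI)
  let ?i = "inv_into (carrier V) h"
  note h = linear_mapsD[OF assms(2)] and m = module_closed[OF assms(1)]
  have inj: "inj_on h (carrier V)" and sur: "h ` carrier V = carrier W"
    using assms(3) by (auto simp: bij_betw_def)
  have i: "?i w \<in> carrier V" "h (?i w) = w" if "w \<in> carrier W" for w
    using that sur by (auto simp: inv_into_into f_inv_into_f)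
  fix w assume w: "w \<in> carrier W"
  show "?i w \<in> carrier V" using i w by simp
  show "?i (w \<oplus>\<^bsub>W\<^esub> w') = ?i w \<oplus>\<^bsub>V\<^esub> ?i w'" if "w' \<in> carrier W" for w'
    by (rule inv_into_f_eq[OF inj]) (simp_all add: i w that h m)
  show "?i (c \<odot>\<^bsub>W\<^esub> w) = c \<odot>\<^bsub>V\<^esub> ?i w" if "c \<in> carrier K" for c
    by (rule inv_into_f_eq[OF inj]) (simp_all add: i w that h m)
qed

text \<open>
  Additive inverses need no separate treatment: multiplication by \<open>-1\<close> provides them.  The price is the
  axiom on multiplication by zero.
\<close>

lemma moduleI_minus_one:
  assumes "cring K"
    and "\<And>v w. v \<in> carrier M \<Longrightarrow> w \<in> carrier M \<Longrightarrow> v \<oplus>\<^bsub>M\<^esub> w \<in> carrier M"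
    and "\<zero>\<^bsub>M\<^esub> \<in> carrier M"
    and "\<And>u v w. u \<in> carrier M \<Longrightarrow> v \<in> carrier M \<Longrightarrow> w \<in> carrier M \<Longrightarrow>
      (u \<oplus>\<^bsub>M\<^esub> v) \<oplus>\<^bsub>M\<^esub> w = u \<oplus>\<^bsub>M\<^esub> (v \<oplus>\<^bsub>M\<^esub> w)"
    and "\<And>v w. v \<in> carrier M \<Longrightarrow> w \<in> carrier M \<Longrightarrow> v \<oplus>\<^bsub>M\<^esub> w = w \<oplus>\<^bsub>M\<^esub> v"
    and "\<And>v. v \<in> carrier M \<Longrightarrow> \<zero>\<^bsub>M\<^esub> \<oplus>\<^bsub>M\<^esub> v = v"
    and sc: "\<And>c v. c \<in> carrier K \<Longrightarrow> v \<in> carrier M \<Longrightarrow> c \<odot>\<^bsub>M\<^esub> v \<in> carrier M"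
    and ld: "\<And>c d v. c \<in> carrier K \<Longrightarrow> d \<in> carrier K \<Longrightarrow> v \<in> carrier M \<Longrightarrow>
      (c \<oplus>\<^bsub>K\<^esub> d) \<odot>\<^bsub>M\<^esub> v = c \<odot>\<^bsub>M\<^esub> v \<oplus>\<^bsub>M\<^esub> d \<odot>\<^bsub>M\<^esub> v"
    and "\<And>c v w. c \<in> carrier K \<Longrightarrow> v \<in> carrier M \<Longrightarrow> w \<in> carrier M \<Longrightarrow>
      c \<odot>\<^bsub>M\<^esub> (v \<oplus>\<^bsub>M\<^esub> w) = c \<odot>\<^bsub>M\<^esub> v \<oplus>\<^bsub>M\<^esub> c \<odot>\<^bsub>M\<^esub> w"
    and "\<And>c d v. c \<in> carrier K \<Longrightarrow> d \<in> carrier K \<Longrightarrow> v \<in> carrier M \<Longrightarrow>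
      (c \<otimes>\<^bsub>K\<^esub> d) \<odot>\<^bsub>M\<^esub> v = c \<odot>\<^bsub>M\<^esub> (d \<odot>\<^bsub>M\<^esub> v)"
    and o: "\<And>v. v \<in> carrier M \<Longrightarrow> \<one>\<^bsub>K\<^esub> \<odot>\<^bsub>M\<^esub> v = v"
    and z: "\<And>v. v \<in> carrier M \<Longrightarrow> \<zero>\<^bsub>K\<^esub> \<odot>\<^bsub>M\<^esub> v = \<zero>\<^bsub>M\<^esub>"
  shows "Module.module K M"
proof -
  interpret K: cring K by fact
  show ?thesis
  proof (rule Module.moduleI)
    show "abelian_group M"
    proof (rule abelian_groupI)
      fix v assume v: "v \<in> carrier M"
      show "\<exists>w\<in>carrier M. w \<oplus>\<^bsub>M\<^esub> v = \<zero>\<^bsub>M\<^esub>"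
      proof
        show "(\<ominus>\<^bsub>K\<^esub> \<one>\<^bsub>K\<^esub>) \<odot>\<^bsub>M\<^esub> v \<in> carrier M" using sc v by simp
        show "(\<ominus>\<^bsub>K\<^esub> \<one>\<^bsub>K\<^esub>) \<odot>\<^bsub>M\<^esub> v \<oplus>\<^bsub>M\<^esub> v = \<zero>\<^bsub>M\<^esub>"
          using ld[of "\<ominus>\<^bsub>K\<^esub> \<one>\<^bsub>K\<^esub>" "\<one>\<^bsub>K\<^esub>" v] v o z by (simp add: K.l_neg)
      qed
    qed (use assms in auto)
  qed (use assms in auto)
qed

lemma pointwise_module_sel [simp]:
  "carrier (pointwise_module I M A) = A"
  "\<zero>\<^bsub>pointwise_module I M A\<^esub> = (\<lambda>i\<in>I. \<zero>\<^bsub>M i\<^esub>)"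
  "s \<oplus>\<^bsub>pointwise_module I M A\<^esub> t = (\<lambda>i\<in>I. s i \<oplus>\<^bsub>M i\<^esub> t i)"
  "c \<odot>\<^bsub>pointwise_module I M A\<^esub> s = (\<lambda>i\<in>I. c \<odot>\<^bsub>M i\<^esub> s i)"
  by (simp_all add: pointwise_module_def)

lemma module_pointwise_module:
  assumes K: "cring K" and M: "\<And>i. i \<in> I \<Longrightarrow> Module.module K (M i)"
    and A: "A \<subseteq> (\<Pi>\<^sub>E i\<in>I. carrier (M i))"
    and "(\<lambda>i\<in>I. \<zero>\<^bsub>M i\<^esub>) \<in> A"
    and "\<And>s t. s \<in> A \<Longrightarrow> t \<in> A \<Longrightarrow> (\<lambda>i\<in>I. s i \<oplus>\<^bsub>M i\<^esub> t i) \<in> A"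
    and "\<And>c s. c \<in> carrier K \<Longrightarrow> s \<in> A \<Longrightarrow> (\<lambda>i\<in>I. c \<odot>\<^bsub>M i\<^esub> s i) \<in> A"
  shows "Module.module K (pointwise_module I M A)"
proof -
  have c: "s i \<in> carrier (M i)" if "s \<in> A" "i \<in> I" for s i
    using A that by auto
  have u: "undefined = s i" if "s \<in> A" "i \<notin> I" for s i
    using A that by (auto simp: PiE_def extensional_def)
  have g: "abelian_group (M i)" if "i \<in> I" for i
    using M[OF that] by (rule Module.module.axioms)
  note ab = abelian_monoid.a_assoc[OF abelian_group.axioms(1)[OF g]]
    abelian_monoid.a_comm[OF abelian_group.axioms(1)[OF g]]
    abelian_monoid.l_zero[OF abelian_group.axioms(1)[OF g]]
  note m = Module.module.smult_l_distr[OF M] Module.module.smult_r_distr[OF M]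
    Module.module.smult_assoc1[OF M] Module.module.smult_one[OF M]
    Module.module.smult_l_null[OF M]
  show ?thesis
    by (rule moduleI_minus_one[OF K]; (simp add: assms)?;
        intro restrict_ext ext; (simp add: c ab m)?) (auto simp: c ab m u)
qed

lemma tensor_eq_lists:
  assumes V: "Module.module K V" and W: "Module.module K W"
    and "tensor_eq K V W xs ys"
  shows "xs \<in> lists (carrier V \<times> carrier W) \<and> ys \<in> lists (carrier V \<times> carrier W)"
  using assms(3) by induction (auto simp: module_closed[OF V] module_closed[OF W])

lemma tensor_class_eqI:
  assumes "tensor_eq K V W xs ys"
  shows "tensor_class K V W xs = tensor_class K V W ys"
  using tensor_eq.trans[OF assms] tensor_eq.trans[OF tensor_eq.sym[OF assms]]
  unfolding tensor_class_def by blast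

lemma map_prod_lists:
  assumes "h \<in> linear_maps K V V'" "xs \<in> lists (carrier V \<times> carrier R)"
  shows "map (map_prod h (\<lambda>r. r)) xs \<in> lists (carrier V' \<times> carrier R)"
  using assms(2) linear_mapsD(1)[OF assms(1)] by (auto simp: lists_eq_set subset_iff)

text \<open>
  A linear map respects each generating relation of the tensor congruence, so applying it to the
  left entries of representatives is well defined on classes.
\<close>

lemma tensor_eq_map:
  assumes V: "Module.module K V" and V': "Module.module K V'"
    and h: "h \<in> linear_maps K V V'" and "tensor_eq K V R xs ys"
  shows "tensor_eq K V' R (map (map_prod h (\<lambda>r. r)) xs) (map (map_prod h (\<lambda>r. r)) ys)"
  using assms(4)
proof induction
  case (refl xs)
  show ?case by (rule tensor_eq.refl[OF map_prod_lists[OF h refl]])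
next
  case (commute xs ys)
  from tensor_eq.commute[OF commute[THEN map_prod_lists[OF h]]] show ?case by simp
next
  case (sym xs ys)
  from sym.IH show ?case by (rule tensor_eq.sym)
next
  case (trans xs ys zs)
  from trans.IH show ?case by (rule tensor_eq.trans)
next
  case (append xs xs' ys ys')
  from tensor_eq.append[OF append.IH] show ?case by simp
next
  case (zero_left w)
  then show ?case by (simp add: linear_maps_zero[OF V V' h] tensor_eq.zero_left)
qed (auto simp: linear_mapsD[OF h]
    intro: tensor_eq.add_left tensor_eq.add_right tensor_eq.balanced)

lemma base_change_map_class:
  assumes V: "Module.module K V" and V': "Module.module K V'" and h: "h \<in> linear_maps K V V'"
    and xs: "xs \<in> lists (carrier V \<times> carrier R)"
  shows "base_change_map K R V' h (tensor_class K V R xs) =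
    tensor_class K V' R (map (map_prod h (\<lambda>r. r)) xs)"
proof -
  have "xs \<in> tensor_class K V R xs"
    using xs by (simp add: tensor_class_def tensor_eq.refl)
  moreover have "tensor_class K V' R (map (map_prod h (\<lambda>r. r)) ys) =
      tensor_class K V' R (map (map_prod h (\<lambda>r. r)) xs)" if "ys \<in> tensor_class K V R xs" for ys
    using that tensor_class_eqI[OF tensor_eq_map[OF V V' h], of R xs ys] by (simp add: tensor_class_def)
  ultimately show ?thesis
    unfolding base_change_map_def tensor_map_def by blast
qed

lemma carrier_base_change:
  "carrier (base_change K R V) = tensor_class K V R ` lists (carrier V \<times> carrier R)"
  by (simp add: base_change_def tensor_def)

lemma base_change_map_comp:
  assumes "Module.module K U" "Module.module K V" "Module.module K W"
    and h: "h \<in> linear_maps K U V" and h': "h' \<in> linear_maps K V W"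
    and g: "g \<in> linear_maps K U W" "\<And>u. u \<in> carrier U \<Longrightarrow> h' (h u) = g u"
    and a: "a \<in> carrier (base_change K R U)"
  shows "base_change_map K R W h' (base_change_map K R V h a) = base_change_map K R W g a"
proof -
  obtain xs where xs: "xs \<in> lists (carrier U \<times> carrier R)" and a: "a = tensor_class K U R xs"
    using a by (auto simp: carrier_base_change)
  have "map (map_prod h' (\<lambda>r. r)) (map (map_prod h (\<lambda>r. r)) xs) = map (map_prod g (\<lambda>r. r)) xs"
    using xs g(2) by (auto simp: lists_eq_set subset_iff)
  then show ?thesis
    using base_change_map_class[OF assms(1,2) h xs]
      base_change_map_class[OF assms(2,3) h' map_prod_lists[OF h xs]]
      base_change_map_class[OF assms(1,3) g(1) xs]
    by (simp only: a)
qed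

lemma base_change_map_closed:
  assumes "Module.module K V" "Module.module K V'" "h \<in> linear_maps K V V'"
    and "a \<in> carrier (base_change K R V)"
  shows "base_change_map K R V' h a \<in> carrier (base_change K R V')"
proof -
  obtain xs where xs: "xs \<in> lists (carrier V \<times> carrier R)" "a = tensor_class K V R xs"
    using assms(4) by (auto simp: carrier_base_change)
  show ?thesis
    unfolding carrier_base_change xs(2) base_change_map_class[OF assms(1-3) xs(1)]
    by (rule imageI[OF map_prod_lists[OF assms(3) xs(1)]])
qed

lemma base_change_map_surj:
  assumes V: "Module.module K V" and V': "Module.module K V'" and h: "h \<in> linear_maps K V V'"
    and sur: "h ` carrier V = carrier V'"
  shows "base_change_map K R V' h ` carrier (base_change K R V) = carrier (base_change K R V')"
proof
  show "base_change_map K R V' h ` carrier (base_change K R V) \<subseteq> carrier (base_change K R V')"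
    using base_change_map_closed[OF V V' h] by blast
  show "carrier (base_change K R V') \<subseteq> base_change_map K R V' h ` carrier (base_change K R V)"
  proof
    fix a assume "a \<in> carrier (base_change K R V')"
    then obtain ys where ys: "ys \<in> lists (carrier V' \<times> carrier R)" and a: "a = tensor_class K V' R ys"
      by (auto simp: carrier_base_change)
    define xs where "xs = map (map_prod (inv_into (carrier V) h) (\<lambda>r. r)) ys"
    have "xs \<in> lists (carrier V \<times> carrier R)"
      using ys sur by (fastforce simp: xs_def lists_eq_set intro!: inv_into_into)
    moreover have "map (map_prod h (\<lambda>r. r)) xs = ys"
      unfolding xs_def map_map using ys
      by (intro map_idI) (auto simp: lists_eq_set sur f_inv_into_f)
    ultimately show "a \<in> base_change_map K R V' h ` carrier (base_change K R V)"
      using base_change_map_class[OF V V' h] a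
      by (metis carrier_base_change imageI)
  qed
qed

text \<open>
  Injectivity cannot be read off from representatives, since equality of classes is a generated
  congruence; it follows by functoriality from the existence of a linear inverse.
\<close>

lemma base_change_map_inj:
  assumes V: "Module.module K V" and V': "Module.module K V'" and h: "h \<in> linear_maps K V V'"
    and bij: "bij_betw h (carrier V) (carrier V')"
  shows "inj_on (base_change_map K R V' h) (carrier (base_change K R V))"
proof (rule inj_on_inverseI)
  fix a assume a: "a \<in> carrier (base_change K R V)"
  then obtain xs where xs: "xs \<in> lists (carrier V \<times> carrier R)" and a': "a = tensor_class K V R xs"
    by (auto simp: carrier_base_change)
  have id: "(\<lambda>v. v) \<in> linear_maps K V V" by (rule linear_mapsI) auto
  have "base_change_map K R V (inv_into (carrier V) h) (base_change_map K R V' h a) =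
      base_change_map K R V (\<lambda>v. v) a"
    by (rule base_change_map_comp[OF V V' V h linear_maps_inv_into[OF V h bij] id _ a])
      (simp add: inv_into_f_f[OF bij_betw_imp_inj_on[OF bij]])
  also have "\<dots> = a"
    using base_change_map_class[OF V V id xs] by (simp add: a' map_prod_def)
  finally show "base_change_map K R V (inv_into (carrier V) h) (base_change_map K R V' h a) = a" .
qed

text \<open>
  This evaluates the operations on classes that are defined as unions over all representatives: it
  suffices that every representative contributes the same class.
\<close>

lemma UN_pairs_const:
  assumes "p \<in> A" and "\<And>U s. (U, s) \<in> A \<Longrightarrow> f U s = c"
  shows "(\<Union>(U, s)\<in>A. f U s) = c"
proof -
  have "(\<Union>(U, s)\<in>A. f U s) = (\<Union>q\<in>A. c)"
    using assms(2) by (intro SUP_cong) auto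
  then show ?thesis using assms(1) by auto
qed

section \<open>Germs and stalks\<close>

lemma is_presheafD:
  assumes "is_presheaf K X F"
  shows "openin X U \<Longrightarrow> Module.module K (sec F U)"
    and "openin X U \<Longrightarrow> openin X V \<Longrightarrow> V \<subseteq> U \<Longrightarrow>
      res F U V \<in> linear_maps K (sec F U) (sec F V)"
    and "openin X U \<Longrightarrow> s \<in> carrier (sec F U) \<Longrightarrow> res F U U s = s"
    and "openin X U \<Longrightarrow> openin X V \<Longrightarrow> openin X W \<Longrightarrow> W \<subseteq> V \<Longrightarrow> V \<subseteq> U \<Longrightarrow>
      s \<in> carrier (sec F U) \<Longrightarrow> res F V W (res F U V s) = res F U W s"
proof -
  note A = assms[unfolded is_presheaf_def]
  show "openin X U \<Longrightarrow> Module.module K (sec F U)"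
    using A by simp
  show "openin X U \<Longrightarrow> openin X V \<Longrightarrow> V \<subseteq> U \<Longrightarrow>
      res F U V \<in> linear_maps K (sec F U) (sec F V)"
    using A[THEN conjunct2, THEN conjunct1] by simp
  show "openin X U \<Longrightarrow> s \<in> carrier (sec F U) \<Longrightarrow> res F U U s = s"
    using A[THEN conjunct2, THEN conjunct2, THEN conjunct1] by simp
  show "openin X U \<Longrightarrow> openin X V \<Longrightarrow> openin X W \<Longrightarrow> W \<subseteq> V \<Longrightarrow> V \<subseteq> U \<Longrightarrow>
      s \<in> carrier (sec F U) \<Longrightarrow> res F V W (res F U V s) = res F U W s"
    using A[THEN conjunct2, THEN conjunct2, THEN conjunct2] by simp
qed

lemma res_closed:
  assumes "is_presheaf K X F" "openin X U" "openin X V" "V \<subseteq> U" "s \<in> carrier (sec F U)"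
  shows "res F U V s \<in> carrier (sec F V)"
  using linear_mapsD(1)[OF is_presheafD(2)[OF assms(1-4)]] assms(5) .

lemma mem_germ_iff:
  "(V, t) \<in> germ X F x U s \<longleftrightarrow> openin X V \<and> x \<in> V \<and> t \<in> carrier (sec F V) \<and>
     (\<exists>W. openin X W \<and> x \<in> W \<and> W \<subseteq> U \<inter> V \<and> res F U W s = res F V W t)"
  by (simp add: germ_def)

lemma germ_eqI:
  assumes F: "is_presheaf K X F" and U: "openin X U" "s \<in> carrier (sec F U)"
    and V: "openin X V" "t \<in> carrier (sec F V)"
    and W: "openin X W" "x \<in> W" "W \<subseteq> U" "W \<subseteq> V" "res F U W s = res F V W t"
  shows "germ X F x U s = germ X F x V t"
proof -
  have *: "germ X F x U s \<subseteq> germ X F x V t"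
    if U: "openin X U" "s \<in> carrier (sec F U)" and V: "openin X V" "t \<in> carrier (sec F V)"
      and W: "W \<subseteq> U" "W \<subseteq> V" "res F U W s = res F V W t" for U V s t
  proof (rule subrelI)
    fix A a assume "(A, a) \<in> germ X F x U s"
    then obtain B where A: "openin X A" "x \<in> A" "a \<in> carrier (sec F A)"
      and B: "openin X B" "x \<in> B" "B \<subseteq> U" "B \<subseteq> A" "res F U B s = res F A B a"
      by (auto simp: mem_germ_iff)
    have BW: "openin X (B \<inter> W)" using B(1) \<open>openin X W\<close> by blast
    have "res F V (B \<inter> W) t = res F W (B \<inter> W) (res F V W t)"
      using is_presheafD(4)[OF F V(1) \<open>openin X W\<close> BW _ W(2) V(2)] by simp
    also have "\<dots> = res F U (B \<inter> W) s"
      using is_presheafD(4)[OF F U(1) \<open>openin X W\<close> BW _ W(1) U(2)] W(3) by simp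
    also have "\<dots> = res F B (B \<inter> W) (res F U B s)"
      using is_presheafD(4)[OF F U(1) B(1) BW _ B(3) U(2)] by simp
    also have "\<dots> = res F A (B \<inter> W) a"
      using is_presheafD(4)[OF F A(1) B(1) BW _ B(4) A(3)] B(5) by simp
    finally show "(A, a) \<in> germ X F x V t"
      using A BW B \<open>x \<in> W\<close> W by (auto simp: mem_germ_iff intro!: exI[of _ "B \<inter> W"])
  qed
  show ?thesis
    using *[OF U V W(3,4,5)] *[OF V U W(4,3) W(5)[symmetric]] by blast
qed

lemma germ_self:
  assumes F: "is_presheaf K X F" and U: "openin X U" "s \<in> carrier (sec F U)" "x \<in> U"
  shows "(U, s) \<in> germ X F x U s"
  unfolding mem_germ_iff using U by (intro conjI exI[of _ U]) auto

lemma germ_eqD: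
  assumes F: "is_presheaf K X F" and V: "openin X V" "t \<in> carrier (sec F V)" "x \<in> V"
    and "germ X F x U s = germ X F x V t"
  obtains W where "openin X W" "x \<in> W" "W \<subseteq> U" "W \<subseteq> V" "res F U W s = res F V W t"
proof -
  have "(V, t) \<in> germ X F x U s"
    using germ_self[OF F V] assms(5) by simp
  then show thesis using that by (auto simp: mem_germ_iff)
qed

lemma germ_res:
  assumes F: "is_presheaf K X F" and U: "openin X U" "s \<in> carrier (sec F U)"
    and W: "openin X W" "W \<subseteq> U" "x \<in> W"
  shows "germ X F x W (res F U W s) = germ X F x U s"
proof -
  note r = res_closed[OF F U(1) W(1,2) U(2)]
  show ?thesis
    by (rule germ_eqI[OF F W(1) r U W(1,3) order_refl W(2) is_presheafD(3)[OF F W(1) r]])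
qed

text \<open>
  Equality of germs is an open condition on the point, which is what lets pointwise identities spread to
  neighbourhoods.
\<close>

lemma germ_eq_near:
  assumes F: "is_presheaf K X F" and U: "openin X U" "s \<in> carrier (sec F U)"
    and V: "openin X V" "t \<in> carrier (sec F V)" "x \<in> V"
    and "germ X F x U s = germ X F x V t"
  obtains W where "openin X W" "x \<in> W" "W \<subseteq> U" "W \<subseteq> V"
    "\<forall>y\<in>W. germ X F y U s = germ X F y V t"
proof -
  obtain W where W: "openin X W" "x \<in> W" "W \<subseteq> U" "W \<subseteq> V" "res F U W s = res F V W t"
    using germ_eqD[OF F V assms(7)] .
  show thesis
    using that[OF W(1-4)] germ_eqI[OF F U V(1,2) W(1) _ W(3-5)] by blast
qed

lemma stalkE:
  assumes "a \<in> carrier (stalk X F x)"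
  obtains U s where "openin X U" "x \<in> U" "s \<in> carrier (sec F U)" "a = germ X F x U s"
  using assms by (auto simp: stalk_def)

lemma germ_in_stalk:
  assumes "openin X U" "x \<in> U" "s \<in> carrier (sec F U)"
  shows "germ X F x U s \<in> carrier (stalk X F x)"
  using assms by (auto simp: stalk_def)

text \<open>
  Representing germs on a common neighbourhood is how every identity in a stalk is reduced to one in a
  module of sections.
\<close>

lemma stalkE2:
  assumes F: "is_presheaf K X F" and a: "a \<in> carrier (stalk X F x)" and b: "b \<in> carrier (stalk X F x)"
  obtains U s t where "openin X U" "x \<in> U" "s \<in> carrier (sec F U)" "t \<in> carrier (sec F U)"
    "a = germ X F x U s" "b = germ X F x U t"
proof -
  obtain U s where U: "openin X U" "x \<in> U" "s \<in> carrier (sec F U)" "a = germ X F x U s"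
    using a by (rule stalkE)
  obtain V t where V: "openin X V" "x \<in> V" "t \<in> carrier (sec F V)" "b = germ X F x V t"
    using b by (rule stalkE)
  have O: "openin X (U \<inter> V)" using U V by blast
  show thesis
    using that[OF O, of "res F U (U \<inter> V) s" "res F V (U \<inter> V) t"] U V O
      res_closed[OF F U(1) O _ U(3)] res_closed[OF F V(1) O _ V(3)]
      germ_res[OF F U(1,3) O] germ_res[OF F V(1,3) O] by auto
qed

lemma stalk_add:
  assumes F: "is_presheaf K X F" and U: "openin X U" "x \<in> U"
    and s: "s \<in> carrier (sec F U)" and t: "t \<in> carrier (sec F U)"
  shows "germ X F x U s \<oplus>\<^bsub>stalk X F x\<^esub> germ X F x U t = germ X F x U (s \<oplus>\<^bsub>sec F U\<^esub> t)"
proof -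
  have *: "germ X F x (A \<inter> B) (res F A (A \<inter> B) a \<oplus>\<^bsub>sec F (A \<inter> B)\<^esub> res F B (A \<inter> B) b) =
      germ X F x U (s \<oplus>\<^bsub>sec F U\<^esub> t)"
    if a: "(A, a) \<in> germ X F x U s" and b: "(B, b) \<in> germ X F x U t" for A B a b
  proof -
    obtain A' where A: "openin X A" "x \<in> A" "a \<in> carrier (sec F A)"
      and A': "openin X A'" "x \<in> A'" "A' \<subseteq> U" "A' \<subseteq> A" "res F U A' s = res F A A' a"
      using a by (auto simp: mem_germ_iff)
    obtain B' where B: "openin X B" "x \<in> B" "b \<in> carrier (sec F B)"
      and B': "openin X B'" "x \<in> B'" "B' \<subseteq> U" "B' \<subseteq> B" "res F U B' t = res F B B' b"
      using b by (auto simp: mem_germ_iff)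
    define W where "W = A' \<inter> B'"
    have W: "openin X W" "x \<in> W" "W \<subseteq> U" "W \<subseteq> A" "W \<subseteq> B" "W \<subseteq> A'" "W \<subseteq> B'" "W \<subseteq> A \<inter> B"
      using A' B' by (auto simp: W_def)
    have O: "openin X (A \<inter> B)" using A B by blast
    have 1: "res F U W s = res F A W a"
      using is_presheafD(4)[OF F U(1) A'(1) W(1,6) A'(3) s]
        is_presheafD(4)[OF F A(1) A'(1) W(1,6) A'(4) A(3)] A'(5) by simp
    have 2: "res F U W t = res F B W b"
      using is_presheafD(4)[OF F U(1) B'(1) W(1,7) B'(3) t]
        is_presheafD(4)[OF F B(1) B'(1) W(1,7) B'(4) B(3)] B'(5) by simp
    note ra = res_closed[OF F A(1) O Int_lower1 A(3)] and rb = res_closed[OF F B(1) O Int_lower2 B(3)]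
    have "res F (A \<inter> B) W (res F A (A \<inter> B) a \<oplus>\<^bsub>sec F (A \<inter> B)\<^esub> res F B (A \<inter> B) b) =
        res F A W a \<oplus>\<^bsub>sec F W\<^esub> res F B W b"
      using linear_mapsD(2)[OF is_presheafD(2)[OF F O W(1,8)] ra rb]
        is_presheafD(4)[OF F A(1) O W(1,8) Int_lower1 A(3)]
        is_presheafD(4)[OF F B(1) O W(1,8) Int_lower2 B(3)] by simp
    also have "\<dots> = res F U W (s \<oplus>\<^bsub>sec F U\<^esub> t)"
      using linear_mapsD(2)[OF is_presheafD(2)[OF F U(1) W(1,3)] s t] 1 2 by simp
    finally show ?thesis
      using O U W s t ra rb module_closed(1)[OF is_presheafD(1)[OF F]]
      by (intro germ_eqI[OF F _ _ _ _ W(1)]) auto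
  qed
  have "(\<Union>(B, b)\<in>germ X F x U t. germ X F x (A \<inter> B)
      (res F A (A \<inter> B) a \<oplus>\<^bsub>sec F (A \<inter> B)\<^esub> res F B (A \<inter> B) b)) = germ X F x U (s \<oplus>\<^bsub>sec F U\<^esub> t)"
    if "(A, a) \<in> germ X F x U s" for A a
    by (rule UN_pairs_const[OF germ_self[OF F U(1) t U(2)]]) (rule *[OF that])
  then show ?thesis
    by (simp add: stalk_def UN_pairs_const[OF germ_self[OF F U(1) s U(2)]])
qed

lemma stalk_smult:
  assumes F: "is_presheaf K X F" and U: "openin X U" "x \<in> U"
    and s: "s \<in> carrier (sec F U)" and c: "c \<in> carrier K"
  shows "c \<odot>\<^bsub>stalk X F x\<^esub> germ X F x U s = germ X F x U (c \<odot>\<^bsub>sec F U\<^esub> s)"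
proof -
  have *: "germ X F x A (c \<odot>\<^bsub>sec F A\<^esub> a) = germ X F x U (c \<odot>\<^bsub>sec F U\<^esub> s)"
    if a: "(A, a) \<in> germ X F x U s" for A a
  proof -
    obtain W where A: "openin X A" "x \<in> A" "a \<in> carrier (sec F A)"
      and W: "openin X W" "x \<in> W" "W \<subseteq> U" "W \<subseteq> A" "res F U W s = res F A W a"
      using a by (auto simp: mem_germ_iff)
    have "res F A W (c \<odot>\<^bsub>sec F A\<^esub> a) = res F U W (c \<odot>\<^bsub>sec F U\<^esub> s)"
      using linear_mapsD(3)[OF is_presheafD(2)[OF F A(1) W(1,4)] c A(3)]
        linear_mapsD(3)[OF is_presheafD(2)[OF F U(1) W(1,3)] c s] W(5) by simp
    then show ?thesis
      using U W A s c module_closed(2)[OF is_presheafD(1)[OF F]]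
      by (intro germ_eqI[OF F _ _ _ _ W(1)]) auto
  qed
  show ?thesis
    by (simp add: stalk_def UN_pairs_const[OF germ_self[OF F U(1) s U(2)] *])
qed

lemma stalk_zero:
  assumes F: "is_presheaf K X F" and U: "openin X U" "x \<in> U"
  shows "\<zero>\<^bsub>stalk X F x\<^esub> = germ X F x U \<zero>\<^bsub>sec F U\<^esub>"
proof -
  have T: "openin X (topspace X)" "U \<subseteq> topspace X" using openin_subset[OF U(1)] by auto
  note m = is_presheafD(1)[OF F]
  have "res F (topspace X) U \<zero>\<^bsub>sec F (topspace X)\<^esub> = \<zero>\<^bsub>sec F U\<^esub>"
    using linear_maps_zero[OF m[OF T(1)] m[OF U(1)] is_presheafD(2)[OF F T(1) U(1) T(2)]] .
  then have "germ X F x U \<zero>\<^bsub>sec F U\<^esub> = germ X F x (topspace X) \<zero>\<^bsub>sec F (topspace X)\<^esub>"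
    using germ_res[OF F T(1) module_closed(3)[OF m[OF T(1)]] U(1) T(2) U(2)] by simp
  then show ?thesis by (simp add: stalk_def)
qed

lemma module_stalk:
  assumes F: "is_presheaf K X F" and x: "x \<in> topspace X"
  shows "Module.module K (stalk X F x)"
proof -
  note M = is_presheafD(1)[OF F]
  let ?S = "stalk X F x"
  have K: "cring K" using M[OF openin_topspace] by (simp add: Module.module_def)
  have g: "abelian_monoid (sec F U)" if "openin X U" for U
    using M[OF that] by (simp add: Module.module_def abelian_group_def)
  note c = module_closed[OF M] and k = cring.cring_simprules(1,2,5,6)[OF K]
  show ?thesis
  proof (rule moduleI_minus_one[OF K])
    show "\<zero>\<^bsub>?S\<^esub> \<in> carrier ?S"
      using stalk_zero[OF F openin_topspace x] x c(3)[of "topspace X"]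
      by (simp add: germ_in_stalk)
  next
    fix a b d assume "a \<in> carrier ?S" and b: "b \<in> carrier ?S" and d: "d \<in> carrier ?S"
    obtain V t u where V: "openin X V" "x \<in> V" "t \<in> carrier (sec F V)" "u \<in> carrier (sec F V)"
      and t: "b = germ X F x V t" and u: "d = germ X F x V u"
      using stalkE2[OF F b d] .
    obtain U s where U: "openin X U" "x \<in> U" "s \<in> carrier (sec F U)" "a = germ X F x U s"
      using \<open>a \<in> carrier ?S\<close> by (rule stalkE)
    define W where "W = U \<inter> V"
    have W: "openin X W" "x \<in> W" "W \<subseteq> U" "W \<subseteq> V" using U V by (auto simp: W_def)
    define s' t' u' where "s' = res F U W s" and "t' = res F V W t" and "u' = res F V W u"
    have r: "s' \<in> carrier (sec F W)" "t' \<in> carrier (sec F W)" "u' \<in> carrier (sec F W)"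
      using res_closed[OF F] U V W by (auto simp: s'_def t'_def u'_def)
    have e: "a = germ X F x W s'" "b = germ X F x W t'" "d = germ X F x W u'"
      using germ_res[OF F] U V W t u by (auto simp: s'_def t'_def u'_def)
    show "a \<oplus>\<^bsub>?S\<^esub> b \<oplus>\<^bsub>?S\<^esub> d = a \<oplus>\<^bsub>?S\<^esub> (b \<oplus>\<^bsub>?S\<^esub> d)"
      using W(1,2) r by (simp add: e stalk_add[OF F] c abelian_monoid.a_assoc[OF g[OF W(1)]])
  next
    fix a b assume a: "a \<in> carrier ?S" and b: "b \<in> carrier ?S"
    obtain U s t where U: "openin X U" "x \<in> U" "s \<in> carrier (sec F U)" "t \<in> carrier (sec F U)"
      and e: "a = germ X F x U s" "b = germ X F x U t"
      using stalkE2[OF F a b] .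
    show "a \<oplus>\<^bsub>?S\<^esub> b \<in> carrier ?S"
      using U by (simp add: e stalk_add[OF F] germ_in_stalk c)
    show "a \<oplus>\<^bsub>?S\<^esub> b = b \<oplus>\<^bsub>?S\<^esub> a"
      using U by (simp add: e stalk_add[OF F] c abelian_monoid.a_comm[OF g[OF U(1)] U(3,4)])
    fix k assume k: "k \<in> carrier K"
    show "k \<odot>\<^bsub>?S\<^esub> (a \<oplus>\<^bsub>?S\<^esub> b) = k \<odot>\<^bsub>?S\<^esub> a \<oplus>\<^bsub>?S\<^esub> k \<odot>\<^bsub>?S\<^esub> b"
      using U k
      by (simp add: e stalk_add[OF F] stalk_smult[OF F] c Module.module.smult_r_distr[OF M[OF U(1)]])
  next
    fix a assume "a \<in> carrier ?S"
    then obtain U s where U: "openin X U" "x \<in> U" "s \<in> carrier (sec F U)" and e: "a = germ X F x U s"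
      by (rule stalkE)
    show "\<zero>\<^bsub>?S\<^esub> \<oplus>\<^bsub>?S\<^esub> a = a"
      using U by (simp add: stalk_zero[OF F U(1,2)] e stalk_add[OF F] c k abelian_monoid.l_zero[OF g[OF U(1)]])
    show "\<one>\<^bsub>K\<^esub> \<odot>\<^bsub>?S\<^esub> a = a"
      using U by (simp add: e stalk_smult[OF F] c k Module.module.smult_one[OF M[OF U(1)]])
    show "\<zero>\<^bsub>K\<^esub> \<odot>\<^bsub>?S\<^esub> a = \<zero>\<^bsub>?S\<^esub>"
      using U by (simp add: stalk_zero[OF F U(1,2)] e stalk_smult[OF F] c k k
          Module.module.smult_l_null[OF M[OF U(1)]])
    fix r l assume r: "r \<in> carrier K"
    show "r \<odot>\<^bsub>?S\<^esub> a \<in> carrier ?S"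
      using U r by (simp add: e stalk_smult[OF F] germ_in_stalk c k k)
    assume l: "l \<in> carrier K"
    show "(r \<oplus>\<^bsub>K\<^esub> l) \<odot>\<^bsub>?S\<^esub> a = r \<odot>\<^bsub>?S\<^esub> a \<oplus>\<^bsub>?S\<^esub> l \<odot>\<^bsub>?S\<^esub> a"
      using U r l by (simp add: e stalk_smult[OF F] stalk_add[OF F] c k k
          Module.module.smult_l_distr[OF M[OF U(1)]])
    show "(r \<otimes>\<^bsub>K\<^esub> l) \<odot>\<^bsub>?S\<^esub> a = r \<odot>\<^bsub>?S\<^esub> (l \<odot>\<^bsub>?S\<^esub> a)"
      using U r l by (simp add: e stalk_smult[OF F] c k Module.module.smult_assoc1[OF M[OF U(1)]])
  qed
qed

section \<open>Inverse images\<close>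

lemma inv_image_sel [simp]:
  "\<zero>\<^bsub>sec (inv_image X Z f F) U\<^esub> = (\<lambda>x\<in>U. \<zero>\<^bsub>stalk Z F (f x)\<^esub>)"
  "s \<oplus>\<^bsub>sec (inv_image X Z f F) U\<^esub> t = (\<lambda>x\<in>U. s x \<oplus>\<^bsub>stalk Z F (f x)\<^esub> t x)"
  "c \<odot>\<^bsub>sec (inv_image X Z f F) U\<^esub> s = (\<lambda>x\<in>U. c \<odot>\<^bsub>stalk Z F (f x)\<^esub> s x)"
  "res (inv_image X Z f F) U V s = restrict s V"
  by (simp_all add: inv_image_def)

lemma inv_image_section_stalk:
  assumes "s \<in> carrier (sec (inv_image X Z f F) U)" "x \<in> U"
  shows "s x \<in> carrier (stalk Z F (f x))"
  using assms by (auto simp: inv_image_def)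

lemma inv_image_section_extensional:
  assumes "s \<in> carrier (sec (inv_image X Z f F) U)"
  shows "s \<in> extensional U"
  using assms by (auto simp: inv_image_def PiE_def)

lemma inv_image_section_near:
  assumes "s \<in> carrier (sec (inv_image X Z f F) U)" "x \<in> U"
  obtains W V t where "openin X W" "x \<in> W" "W \<subseteq> U" "openin Z V" "f ` W \<subseteq> V"
    "t \<in> carrier (sec F V)" "\<forall>y\<in>W. s y = germ Z F (f y) V t"
proof -
  have "\<forall>x\<in>U. \<exists>W V t. openin X W \<and> x \<in> W \<and> W \<subseteq> U \<and> openin Z V \<and> f ` W \<subseteq> V \<and>
      t \<in> carrier (sec F V) \<and> (\<forall>y\<in>W. s y = germ Z F (f y) V t)"
    using assms(1) by (simp add: inv_image_def)
  then show thesis using that assms(2) by meson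
qed

lemma inv_image_sectionI:
  assumes U: "openin X U" and s: "s \<in> extensional U"
    and near: "\<And>x. x \<in> U \<Longrightarrow> \<exists>W V t. openin X W \<and> x \<in> W \<and> openin Z V \<and> t \<in> carrier (sec F V) \<and>
      (\<forall>y\<in>W \<inter> U. f y \<in> V \<and> s y = germ Z F (f y) V t)"
  shows "s \<in> carrier (sec (inv_image X Z f F) U)"
proof -
  have *: "\<exists>W V t. openin X W \<and> x \<in> W \<and> W \<subseteq> U \<and> openin Z V \<and> f ` W \<subseteq> V \<and>
      t \<in> carrier (sec F V) \<and> (\<forall>y\<in>W. s y = germ Z F (f y) V t)" if x: "x \<in> U" for x
  proof -
    obtain W V t where "openin X W" "x \<in> W" "openin Z V" "t \<in> carrier (sec F V)"
      "\<forall>y\<in>W \<inter> U. f y \<in> V \<and> s y = germ Z F (f y) V t"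
      using near[OF x] by blast
    then show ?thesis
      using U x by (intro exI[of _ "W \<inter> U"] exI[of _ V] exI[of _ t]) auto
  qed
  have "s x \<in> carrier (stalk Z F (f x))" if "x \<in> U" for x
    using near[OF that] that by (fastforce intro!: germ_in_stalk)
  then have "s \<in> (\<Pi>\<^sub>E x\<in>U. carrier (stalk Z F (f x)))"
    using s by (simp add: PiE_iff)
  then show ?thesis
    using * by (simp add: inv_image_def)
qed

lemma inv_image_section_add:
  assumes F: "is_presheaf K Z F" and U: "openin X U"
    and s: "s \<in> carrier (sec (inv_image X Z f F) U)"
    and t: "t \<in> carrier (sec (inv_image X Z f F) U)"
  shows "(\<lambda>x\<in>U. s x \<oplus>\<^bsub>stalk Z F (f x)\<^esub> t x) \<in> carrier (sec (inv_image X Z f F) U)"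
proof (rule inv_image_sectionI[OF U restrict_extensional])
  fix x assume x: "x \<in> U"
  obtain W V a where 1: "openin X W" "x \<in> W" "W \<subseteq> U" "openin Z V" "f ` W \<subseteq> V"
    "a \<in> carrier (sec F V)" "\<forall>y\<in>W. s y = germ Z F (f y) V a"
    using inv_image_section_near[OF s x] .
  obtain W' V' b where 2: "openin X W'" "x \<in> W'" "W' \<subseteq> U" "openin Z V'" "f ` W' \<subseteq> V'"
    "b \<in> carrier (sec F V')" "\<forall>y\<in>W'. t y = germ Z F (f y) V' b"
    using inv_image_section_near[OF t x] .
  let ?V = "V \<inter> V'"
  have O: "openin Z ?V" using 1 2 by blast
  let ?a = "res F V ?V a" and ?b = "res F V' ?V b"
  have ra: "?a \<in> carrier (sec F ?V)" and rb: "?b \<in> carrier (sec F ?V)"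
    using res_closed[OF F 1(4) O _ 1(6)] res_closed[OF F 2(4) O _ 2(6)] by auto
  have e: "f y \<in> ?V \<and>
      s y \<oplus>\<^bsub>stalk Z F (f y)\<^esub> t y = germ Z F (f y) ?V (?a \<oplus>\<^bsub>sec F ?V\<^esub> ?b)" if "y \<in> W \<inter> W'" for y
  proof -
    have y: "f y \<in> ?V" using that 1 2 by blast
    have "s y = germ Z F (f y) ?V ?a" "t y = germ Z F (f y) ?V ?b"
      using germ_res[OF F 1(4,6) O _ y] germ_res[OF F 2(4,6) O _ y] 1(7)[rule_format, of y] 2(7)[rule_format, of y] that
      by auto
    then show ?thesis using stalk_add[OF F O y ra rb] y by simp
  qed
  show "\<exists>W V a. openin X W \<and> x \<in> W \<and> openin Z V \<and> a \<in> carrier (sec F V) \<and> (\<forall>y\<in>W \<inter> U.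
      f y \<in> V \<and> (\<lambda>x\<in>U. s x \<oplus>\<^bsub>stalk Z F (f x)\<^esub> t x) y = germ Z F (f y) V a)"
    using 1(1,2) 2(1,2) O e module_closed(1)[OF is_presheafD(1)[OF F O] ra rb]
    by (intro exI[of _ "W \<inter> W'"] exI[of _ ?V] exI[of _ "?a \<oplus>\<^bsub>sec F ?V\<^esub> ?b"]) auto
qed

lemma inv_image_section_smult:
  assumes F: "is_presheaf K Z F" and U: "openin X U" and c: "c \<in> carrier K"
    and s: "s \<in> carrier (sec (inv_image X Z f F) U)"
  shows "(\<lambda>x\<in>U. c \<odot>\<^bsub>stalk Z F (f x)\<^esub> s x) \<in> carrier (sec (inv_image X Z f F) U)"
proof (rule inv_image_sectionI[OF U restrict_extensional])
  fix x assume x: "x \<in> U"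
  obtain W V a where 1: "openin X W" "x \<in> W" "W \<subseteq> U" "openin Z V" "f ` W \<subseteq> V"
    "a \<in> carrier (sec F V)" "\<forall>y\<in>W. s y = germ Z F (f y) V a"
    using inv_image_section_near[OF s x] .
  have e: "f y \<in> V \<and> c \<odot>\<^bsub>stalk Z F (f y)\<^esub> s y = germ Z F (f y) V (c \<odot>\<^bsub>sec F V\<^esub> a)"
    if "y \<in> W" for y
    using stalk_smult[OF F 1(4) _ 1(6) c, of "f y"] 1(5,7) that by auto
  show "\<exists>W V a. openin X W \<and> x \<in> W \<and> openin Z V \<and> a \<in> carrier (sec F V) \<and> (\<forall>y\<in>W \<inter> U.
      f y \<in> V \<and> (\<lambda>x\<in>U. c \<odot>\<^bsub>stalk Z F (f x)\<^esub> s x) y = germ Z F (f y) V a)"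
    using 1(1,2,4) e module_closed(2)[OF is_presheafD(1)[OF F 1(4)] c 1(6)]
    by (intro exI[of _ W] exI[of _ V] exI[of _ "c \<odot>\<^bsub>sec F V\<^esub> a"]) auto
qed

lemma module_inv_image_sections:
  assumes F: "is_presheaf K Z F" and f: "continuous_map X Z f" and U: "openin X U"
  shows "Module.module K (sec (inv_image X Z f F) U)"
proof -
  let ?A = "carrier (sec (inv_image X Z f F) U)"
  note m = is_presheafD(1)[OF F openin_topspace]
  have K: "cring K" using m by (simp add: Module.module_def)
  have fU: "f x \<in> topspace Z" if "x \<in> U" for x
    using continuous_map_image_subset_topspace[OF f] openin_subset[OF U] that by blast
  have z: "(\<lambda>x\<in>U. \<zero>\<^bsub>stalk Z F (f x)\<^esub>) \<in> ?A"
    using U fU module_closed(3)[OF m] stalk_zero[OF F openin_topspace]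
    by (intro inv_image_sectionI[OF U restrict_extensional] exI[of _ U] exI[of _ "topspace Z"]
        exI[of _ "\<zero>\<^bsub>sec F (topspace Z)\<^esub>"]) auto
  have "?A \<subseteq> (\<Pi>\<^sub>E x\<in>U. carrier (stalk Z F (f x)))"
    by (auto simp: inv_image_def)
  then have "Module.module K (pointwise_module U (\<lambda>x. stalk Z F (f x)) ?A)"
    using module_stalk[OF F fU] z inv_image_section_add[OF F U] inv_image_section_smult[OF F U]
    by (intro module_pointwise_module[OF K]) auto
  moreover have "sec (inv_image X Z f F) U = pointwise_module U (\<lambda>x. stalk Z F (f x)) ?A"
    by (simp add: inv_image_def)
  ultimately show ?thesis by simp
qed

lemma inv_image_section_restrict:
  assumes U: "openin X U" "openin X V" "V \<subseteq> U"
    and s: "s \<in> carrier (sec (inv_image X Z f F) U)"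
  shows "restrict s V \<in> carrier (sec (inv_image X Z f F) V)"
proof (rule inv_image_sectionI[OF U(2) restrict_extensional])
  fix x assume "x \<in> V"
  then obtain W N a where 1: "openin X W" "x \<in> W" "W \<subseteq> U" "openin Z N" "f ` W \<subseteq> N"
    "a \<in> carrier (sec F N)" "\<forall>y\<in>W. s y = germ Z F (f y) N a"
    using inv_image_section_near[OF s] U(3) by blast
  then show "\<exists>W N a. openin X W \<and> x \<in> W \<and> openin Z N \<and> a \<in> carrier (sec F N) \<and> (\<forall>y\<in>W \<inter> V.
      f y \<in> N \<and> restrict s V y = germ Z F (f y) N a)"
    by (intro exI[of _ W] exI[of _ N] exI[of _ a]) auto
qed

lemma is_presheaf_inv_image:
  assumes F: "is_presheaf K Z F" and f: "continuous_map X Z f"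
  shows "is_presheaf K X (inv_image X Z f F)"
proof -
  have "(\<lambda>s. restrict s V) \<in> linear_maps K (sec (inv_image X Z f F) U) (sec (inv_image X Z f F) V)"
    if "openin X U" "openin X V" "V \<subseteq> U" for U V
    using inv_image_section_restrict[OF that] that(3)
    by (intro linear_mapsI) (auto intro!: restrict_ext simp: Int_absorb1)
  then have "res (inv_image X Z f F) U V \<in>
      linear_maps K (sec (inv_image X Z f F) U) (sec (inv_image X Z f F) V)"
    if "openin X U" "openin X V" "V \<subseteq> U" for U V
    using that by (simp add: inv_image_def)
  moreover have "restrict s U = s" if "s \<in> carrier (sec (inv_image X Z f F) U)" for U s
    using inv_image_section_extensional[OF that] by (rule extensional_restrict)
  ultimately show ?thesis
    unfolding is_presheaf_def using module_inv_image_sections[OF F f] by (simp add: Int_absorb1)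
qed

lemma is_sheaf_inv_image:
  assumes F: "is_presheaf K Z F" and f: "continuous_map X Z f"
  shows "is_sheaf K X (inv_image X Z f F)"
  unfolding is_sheaf_def
proof (intro conjI allI impI is_presheaf_inv_image[OF F f])
  fix \<U> \<sigma>
  let ?G = "inv_image X Z f F"
  assume *: "(\<forall>U\<in>\<U>. openin X U \<and> \<sigma> U \<in> carrier (sec ?G U)) \<and>
    (\<forall>U\<in>\<U>. \<forall>V\<in>\<U>. res ?G U (U \<inter> V) (\<sigma> U) = res ?G V (U \<inter> V) (\<sigma> V))"
  then have open_U: "openin X U" and sec_U: "\<sigma> U \<in> carrier (sec ?G U)" if "U \<in> \<U>" for U
    using that by auto
  have agree: "\<sigma> U x = \<sigma> V x" if "U \<in> \<U>" "V \<in> \<U>" "x \<in> U" "x \<in> V" for U V x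
  proof -
    have "res ?G U (U \<inter> V) (\<sigma> U) = res ?G V (U \<inter> V) (\<sigma> V)" using * that by blast
    then have "restrict (\<sigma> U) (U \<inter> V) = restrict (\<sigma> V) (U \<inter> V)" by (simp only: inv_image_sel)
    from fun_cong[OF this, of x] show ?thesis using that by simp
  qed
  define s where "s = (\<lambda>x\<in>\<Union>\<U>. \<sigma> (SOME U. U \<in> \<U> \<and> x \<in> U) x)"
  have s: "s x = \<sigma> U x" if "U \<in> \<U>" "x \<in> U" for U x
  proof -
    define U' where "U' = (SOME U. U \<in> \<U> \<and> x \<in> U)"
    have "U' \<in> \<U> \<and> x \<in> U'"
      unfolding U'_def by (rule someI[of _ U]) (use that in blast)
    then have "\<sigma> U' x = \<sigma> U x" using agree that by blast
    moreover have "x \<in> \<Union>\<U>" using that by blast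
    then have "s x = \<sigma> U' x" unfolding s_def U'_def by (rule restrict_apply')
    ultimately show ?thesis by simp
  qed
  have O: "openin X (\<Union>\<U>)" using open_U by blast
  show "\<exists>!s. s \<in> carrier (sec ?G (\<Union>\<U>)) \<and> (\<forall>U\<in>\<U>. res ?G (\<Union>\<U>) U s = \<sigma> U)"
  proof (intro ex1I conjI ballI)
    show "s \<in> carrier (sec ?G (\<Union>\<U>))"
    proof (rule inv_image_sectionI[OF O])
      show "s \<in> extensional (\<Union>\<U>)" by (simp add: s_def)
      fix x assume "x \<in> \<Union>\<U>"
      then obtain U where U: "U \<in> \<U>" "x \<in> U" by blast
      obtain W N a where "openin X W" "x \<in> W" "W \<subseteq> U" "openin Z N" "f ` W \<subseteq> N"
        "a \<in> carrier (sec F N)" "\<forall>y\<in>W. \<sigma> U y = germ Z F (f y) N a"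
        using inv_image_section_near[OF sec_U[OF U(1)] U(2)] .
      then show "\<exists>W N a. openin X W \<and> x \<in> W \<and> openin Z N \<and> a \<in> carrier (sec F N) \<and>
          (\<forall>y\<in>W \<inter> \<Union>\<U>. f y \<in> N \<and> s y = germ Z F (f y) N a)"
        using s[OF U(1)] by (intro exI[of _ W] exI[of _ N] exI[of _ a]) auto
    qed
    show "res ?G (\<Union>\<U>) U s = \<sigma> U" if "U \<in> \<U>" for U
    proof -
      have "restrict s U = restrict (\<sigma> U) U" using s[OF that] by (rule restrict_ext)
      then show ?thesis
        using extensional_restrict[OF inv_image_section_extensional[OF sec_U[OF that]]] by simp
    qed
    fix t assume t: "t \<in> carrier (sec ?G (\<Union>\<U>)) \<and> (\<forall>U\<in>\<U>. res ?G (\<Union>\<U>) U t = \<sigma> U)"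
    have "t x = s x" if x: "x \<in> \<Union>\<U>" for x
    proof -
      obtain U where U: "U \<in> \<U>" "x \<in> U" using x by blast
      then have "restrict t U x = \<sigma> U x" using t by simp
      then show ?thesis using s[OF U] U(2) by simp
    qed
    moreover have "t \<in> extensional (\<Union>\<U>)" "s \<in> extensional (\<Union>\<U>)"
      using inv_image_section_extensional t by (blast, simp add: s_def)
    ultimately show "t = s" by (blast intro: extensionalityI)
  qed
qed

text \<open>
  All representatives of the germ agree with \<open>s\<close> near \<open>x\<close>, in particular at \<open>x\<close>, so the image in the
  definition of the comparison map is a singleton.
\<close>

lemma inv_image_stalk_germ:
  assumes F: "is_presheaf K Z F" and f: "continuous_map X Z f"
    and U: "openin X U" "x \<in> U" and s: "s \<in> carrier (sec (inv_image X Z f F) U)"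
  shows "inv_image_stalk x (germ X (inv_image X Z f F) x U s) = s x"
proof -
  let ?g = "germ X (inv_image X Z f F) x U s"
  have "(U, s) \<in> ?g"
    by (rule germ_self[OF is_presheaf_inv_image[OF F f] U(1) s U(2)])
  moreover have "t x = s x" if "(V, t) \<in> ?g" for V t
  proof -
    obtain W where W: "x \<in> W" "restrict s W = restrict t W"
      using \<open>(V, t) \<in> ?g\<close> by (auto simp: mem_germ_iff)
    from fun_cong[OF W(2), of x] W(1) show ?thesis by simp
  qed
  then have "(\<lambda>(U, s). s x) ` ?g = (\<lambda>_. s x) ` ?g"
    by (intro image_cong) auto
  ultimately have "(\<lambda>(U, s). s x) ` ?g = {s x}"
    by (simp only: image_constant)
  then show ?thesis by (simp add: inv_image_stalk_def)
qed

lemma linear_inv_image_stalk: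
  assumes F: "is_presheaf K Z F" and f: "continuous_map X Z f"
  shows "inv_image_stalk x \<in> linear_maps K (stalk X (inv_image X Z f F) x) (stalk Z F (f x))"
proof (rule linear_mapsI)
  let ?G = "inv_image X Z f F"
  note G = is_presheaf_inv_image[OF F f]
  note g = inv_image_stalk_germ[OF F f]
  fix a assume a: "a \<in> carrier (stalk X ?G x)"
  then obtain U s where U: "openin X U" "x \<in> U" "s \<in> carrier (sec ?G U)" "a = germ X ?G x U s"
    by (rule stalkE)
  show "inv_image_stalk x a \<in> carrier (stalk Z F (f x))"
    using g[OF U(1-3)] inv_image_section_stalk[OF U(3,2)] by (simp add: U(4))
  show "inv_image_stalk x (c \<odot>\<^bsub>stalk X ?G x\<^esub> a) = c \<odot>\<^bsub>stalk Z F (f x)\<^esub> inv_image_stalk x a"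
    if c: "c \<in> carrier K" for c
    using g[OF U(1-3)] g[OF U(1,2) module_closed(2)[OF is_presheafD(1)[OF G U(1)] c U(3)]]
      stalk_smult[OF G U(1-3) c] U(2) by (simp add: U(4))
  fix b assume b: "b \<in> carrier (stalk X ?G x)"
  obtain U s t where U: "openin X U" "x \<in> U" "s \<in> carrier (sec ?G U)" "t \<in> carrier (sec ?G U)"
    "a = germ X ?G x U s" "b = germ X ?G x U t"
    using stalkE2[OF G a b] .
  show "inv_image_stalk x (a \<oplus>\<^bsub>stalk X ?G x\<^esub> b) =
      inv_image_stalk x a \<oplus>\<^bsub>stalk Z F (f x)\<^esub> inv_image_stalk x b"
    using g[OF U(1-3)] g[OF U(1,2,4)]
      g[OF U(1,2) module_closed(1)[OF is_presheafD(1)[OF G U(1)] U(3,4)]]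
      stalk_add[OF G U(1-4)] U(2) by (simp add: U(5,6))
qed

lemma inv_image_section_of_section:
  assumes f: "continuous_map X Z f" and V: "openin Z V" and t: "t \<in> carrier (sec F V)"
    and U: "openin X U" "f ` U \<subseteq> V"
  shows "(\<lambda>y\<in>U. germ Z F (f y) V t) \<in> carrier (sec (inv_image X Z f F) U)"
  using assms
  by (intro inv_image_sectionI[OF U(1) restrict_extensional] exI[of _ U] exI[of _ V] exI[of _ t]) auto

text \<open>
  If two sections have the same value at \<open>x\<close>, then the sections of \<open>F\<close> inducing them have the same
  germ at \<open>f x\<close>, hence agree near \<open>f x\<close>, and continuity of \<open>f\<close> makes the two sections agree near \<open>x\<close>.
\<close>

lemma bij_inv_image_stalk:
  assumes F: "is_presheaf K Z F" and f: "continuous_map X Z f" and x: "x \<in> topspace X"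
  shows "bij_betw (inv_image_stalk x) (carrier (stalk X (inv_image X Z f F) x))
    (carrier (stalk Z F (f x)))"
proof (rule bij_betwI')
  let ?G = "inv_image X Z f F"
  note G = is_presheaf_inv_image[OF F f]
  note g = inv_image_stalk_germ[OF F f]
  fix a assume a: "a \<in> carrier (stalk X ?G x)"
  show "inv_image_stalk x a \<in> carrier (stalk Z F (f x))"
    using linear_mapsD(1)[OF linear_inv_image_stalk[OF F f] a] .
  fix b assume b: "b \<in> carrier (stalk X ?G x)"
  obtain U s t where U: "openin X U" "x \<in> U" and s: "s \<in> carrier (sec ?G U)"
    and t: "t \<in> carrier (sec ?G U)" and e: "a = germ X ?G x U s" "b = germ X ?G x U t"
    using stalkE2[OF G a b] .
  show "(inv_image_stalk x a = inv_image_stalk x b) = (a = b)"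
  proof
    assume "inv_image_stalk x a = inv_image_stalk x b"
    then have st: "s x = t x" using g[OF U s] g[OF U t] by (simp add: e)
    obtain W V c where 1: "openin X W" "x \<in> W" "W \<subseteq> U" "openin Z V" "f ` W \<subseteq> V"
      "c \<in> carrier (sec F V)" "\<forall>y\<in>W. s y = germ Z F (f y) V c"
      using inv_image_section_near[OF s U(2)] .
    obtain W' V' c' where 2: "openin X W'" "x \<in> W'" "W' \<subseteq> U" "openin Z V'" "f ` W' \<subseteq> V'"
      "c' \<in> carrier (sec F V')" "\<forall>y\<in>W'. t y = germ Z F (f y) V' c'"
      using inv_image_section_near[OF t U(2)] .
    have fx: "f x \<in> V'" using 2(2,5) by blast
    have "germ Z F (f x) V c = germ Z F (f x) V' c'" using st 1(2,7) 2(2,7) by simp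
    then obtain N where N: "openin Z N" "f x \<in> N" "N \<subseteq> V" "N \<subseteq> V'"
      "\<forall>z\<in>N. germ Z F z V c = germ Z F z V' c'"
      by (rule germ_eq_near[OF F 1(4,6) 2(4,6) fx])
    define B where "B = W \<inter> W' \<inter> {y \<in> topspace X. f y \<in> N}"
    have B: "openin X B" "x \<in> B" "B \<subseteq> U"
      using 1(1-3) 2(1-3) N openin_continuous_map_preimage[OF f N(1)] x by (auto simp: B_def)
    have "s y = t y" if "y \<in> B" for y
      using that 1(7) 2(7) N(5) by (simp add: B_def)
    then have "res ?G U B s = res ?G U B t" by (auto intro!: restrict_ext)
    then show "a = b"
      unfolding e by (rule germ_eqI[OF G U(1) s U(1) t B B(3)])
  qed simp
next
  let ?G = "inv_image X Z f F"
  fix b assume "b \<in> carrier (stalk Z F (f x))"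
  then obtain V t where V: "openin Z V" "f x \<in> V" "t \<in> carrier (sec F V)" "b = germ Z F (f x) V t"
    by (rule stalkE)
  define U where "U = {y \<in> topspace X. f y \<in> V}"
  have U: "openin X U" "x \<in> U" "f ` U \<subseteq> V"
    using openin_continuous_map_preimage[OF f V(1)] V(2) x by (auto simp: U_def)
  note s = inv_image_section_of_section[OF f V(1,3) U(1,3)]
  show "\<exists>a\<in>carrier (stalk X ?G x). b = inv_image_stalk x a"
    using germ_in_stalk[OF U(1,2) s] inv_image_stalk_germ[OF F f U(1,2) s] U(2) V(4)
    by (intro bexI) auto
qed

section \<open>Local systems\<close>

lemma module_self_module:
  assumes "cring K"
  shows "Module.module K (self_module K)"
proof -
  interpret cring K by fact
  show ?thesis
    by (rule moduleI_minus_one[OF assms]) (auto simp: self_module_def m_assoc a_assoc a_comm a_lcomm l_distr r_distr)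
qed

lemma module_coord_space:
  assumes "cring K"
  shows "Module.module K (coord_space K n)"
  unfolding coord_space_def
  by (rule module_pointwise_module[OF assms module_self_module[OF assms]])
    (use module_closed[OF module_self_module[OF assms]] in \<open>auto simp: self_module_def PiE_iff\<close>)

text \<open>
  A local trivialisation in terms of germs: \<open>c\<close> sends a vector to the section that is constant
  with this value, and at each point of \<open>V\<close> every germ is the germ of exactly one such section.  Since
  \<open>V\<close> need not be connected, these are in general not all sections over \<open>V\<close>.
\<close>

definition local_frame ::
  "'k ring \<Rightarrow> 'z topology \<Rightarrow> ('k, 'z, 's) presheaf \<Rightarrow> 'z set \<Rightarrow> nat \<Rightarrow> ((nat \<Rightarrow> 'k) \<Rightarrow> 's) \<Rightarrow> bool"
  where "local_frame K Z E V n c \<longleftrightarrow> openin Z V \<and> c \<in> linear_maps K (coord_space K n) (sec E V) \<and>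
    (\<forall>p\<in>V. bij_betw (\<lambda>v. germ Z E p V (c v)) (carrier (coord_space K n)) (carrier (stalk Z E p)))"

lemma local_frameD:
  assumes "local_frame K Z E V n c"
  shows "openin Z V" and "c \<in> linear_maps K (coord_space K n) (sec E V)"
    and "p \<in> V \<Longrightarrow>
      bij_betw (\<lambda>v. germ Z E p V (c v)) (carrier (coord_space K n)) (carrier (stalk Z E p))"
    and "v \<in> carrier (coord_space K n) \<Longrightarrow> c v \<in> carrier (sec E V)"
  using assms linear_mapsD(1)[of c K "coord_space K n" "sec E V" v] by (simp_all add: local_frame_def)

lemma local_frame_germ_surj:
  assumes "local_frame K Z E V n c" "p \<in> V" "a \<in> carrier (stalk Z E p)"
  obtains v where "v \<in> carrier (coord_space K n)" "a = germ Z E p V (c v)"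
  using local_frameD(3)[OF assms(1,2)] assms(3) unfolding bij_betw_def by blast

lemma local_frame_germ_inj:
  assumes "local_frame K Z E V n c" "p \<in> V" "v \<in> carrier (coord_space K n)" "w \<in> carrier (coord_space K n)"
    and "germ Z E p V (c v) = germ Z E p V (c w)"
  shows "v = w"
  using local_frameD(3)[OF assms(1,2)] assms(3-5) unfolding bij_betw_def inj_on_def by blast

lemma local_frame_germ_linear:
  assumes E: "is_presheaf K Z E" and c: "local_frame K Z E V n c" and p: "p \<in> V"
  shows "(\<lambda>v. germ Z E p V (c v)) \<in> linear_maps K (coord_space K n) (stalk Z E p)"
  using stalk_add[OF E local_frameD(1)[OF c] p] stalk_smult[OF E local_frameD(1)[OF c] p] local_frameD(4)[OF c]
    linear_mapsD[OF local_frameD(2)[OF c]] germ_in_stalk[OF local_frameD(1)[OF c] p, of _ E]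
  by (intro linear_mapsI) auto

lemma const_section:
  "v \<in> carrier M \<Longrightarrow> openin Y U \<Longrightarrow> (\<lambda>_\<in>U. v) \<in> carrier (sec (const_sheaf Y M) U)"
  by (auto simp: const_sheaf_def)

lemma const_sheaf_sel:
  "res (const_sheaf Y M) U V s = restrict s V"
  "carrier (sec (const_sheaf Y M) U) = {s \<in> U \<rightarrow>\<^sub>E carrier M.
     \<forall>x\<in>U. \<exists>W. openin Y W \<and> x \<in> W \<and> W \<subseteq> U \<and> (\<forall>y\<in>W. s y = s x)}"
  "s \<oplus>\<^bsub>sec (const_sheaf Y M) U\<^esub> t = (\<lambda>x\<in>U. s x \<oplus>\<^bsub>M\<^esub> t x)"
  "c \<odot>\<^bsub>sec (const_sheaf Y M) U\<^esub> s = (\<lambda>x\<in>U. c \<odot>\<^bsub>M\<^esub> s x)"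
  by (simp_all add: const_sheaf_def)

lemma const_sheaf_section_near:
  assumes "l \<in> carrier (sec (const_sheaf Y M) U)" "y \<in> U"
  obtains W v where "openin Y W" "y \<in> W" "W \<subseteq> U" "v \<in> carrier M" "\<forall>q\<in>W. l q = v"
proof -
  obtain W where W: "openin Y W" "y \<in> W" "W \<subseteq> U" "\<forall>q\<in>W. l q = l y"
    using assms unfolding const_sheaf_sel by blast
  have "l y \<in> carrier M" using assms unfolding const_sheaf_sel by blast
  then show thesis by (rule that[OF W(1-3) _ W(4)])
qed

text \<open>
  The frame consists of the preimages of the constant functions under the trivialisation.  Every germ
  is represented by one of them because a locally constant function is constant near each point.
\<close>

lemma local_system_local_frame:
  assumes E: "local_system K Z E" and z: "z \<in> topspace Z"
  obtains V n c where "local_frame K Z E V n c" "z \<in> V"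
proof -
  have P: "is_presheaf K Z E" using E by (simp add: local_system_def is_sheaf_def)
  obtain V n \<phi> where V: "openin Z V" "z \<in> V"
    and \<phi>: "sheaf_iso K (subtopology Z V) E (const_sheaf (subtopology Z V) (coord_space K n)) \<phi>"
    using E z by (auto simp: local_system_def)
  let ?C = "const_sheaf (subtopology Z V) (coord_space K n)"
  let ?M = "coord_space K n"
  have sub: "openin (subtopology Z V) U \<longleftrightarrow> openin Z U \<and> U \<subseteq> V" for U
    using openin_open_subtopology[OF V(1)] by auto
  have lin: "\<phi> U \<in> linear_maps K (sec E U) (sec ?C U)"
    and bij: "bij_betw (\<phi> U) (carrier (sec E U)) (carrier (sec ?C U))"
    if "openin Z U" "U \<subseteq> V" for U
    using \<phi> that by (auto simp: sheaf_iso_def sheaf_hom_def sub)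
  have nat: "\<phi> W (res E U W s) = restrict (\<phi> U s) W"
    if "openin Z U" "U \<subseteq> V" "openin Z W" "W \<subseteq> U" "s \<in> carrier (sec E U)" for U W s
  proof -
    have "\<phi> W (res E U W s) = res ?C U W (\<phi> U s)"
      using \<phi> that by (auto simp: sheaf_iso_def sheaf_hom_def sub)
    then show ?thesis by (simp add: const_sheaf_sel)
  qed
  have module_V: "Module.module K (sec E V)" by (rule is_presheafD(1)[OF P V(1)])
  have cK: "cring K" using module_V by (simp add: Module.module_def)
  note mM = module_closed[OF module_coord_space[OF cK, of n]]
  define c where "c v = inv_into (carrier (sec E V)) (\<phi> V) (\<lambda>_\<in>V. v)" for v
  have const: "(\<lambda>_\<in>V. v) \<in> carrier (sec ?C V)" if "v \<in> carrier ?M" for v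
    using const_section[OF that, of "subtopology Z V" V] V(1) by (simp add: sub)
  have c: "c v \<in> carrier (sec E V)" "\<phi> V (c v) = (\<lambda>_\<in>V. v)" if "v \<in> carrier ?M" for v
    using const[OF that] bij[OF V(1) order_refl] unfolding c_def bij_betw_def
    by (auto simp: inv_into_into f_inv_into_f)
  have inj: "s = t" if "openin Z U" "U \<subseteq> V" "s \<in> carrier (sec E U)" "t \<in> carrier (sec E U)"
    "\<phi> U s = \<phi> U t" for U s t
    using bij[OF that(1,2)] that(3-5) unfolding bij_betw_def inj_on_def by blast
  note lV = linear_mapsD[OF lin[OF V(1) order_refl]]
  have clin: "c \<in> linear_maps K ?M (sec E V)"
  proof (rule linear_mapsI)
    fix v assume v: "v \<in> carrier ?M"
    then show "c v \<in> carrier (sec E V)" by (rule c)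
    show "c (v \<oplus>\<^bsub>?M\<^esub> w) = c v \<oplus>\<^bsub>sec E V\<^esub> c w" if w: "w \<in> carrier ?M" for w
    proof (rule inj[OF V(1) order_refl])
      show "\<phi> V (c (v \<oplus>\<^bsub>?M\<^esub> w)) = \<phi> V (c v \<oplus>\<^bsub>sec E V\<^esub> c w)"
        using lV(2)[OF c(1)[OF v] c(1)[OF w]] c(2)[OF v] c(2)[OF w] c(2)[OF mM(1)[OF v w]]
        by (auto simp: const_sheaf_sel)
    qed (use c v w mM module_closed[OF module_V] in auto)
    show "c (k \<odot>\<^bsub>?M\<^esub> v) = k \<odot>\<^bsub>sec E V\<^esub> c v" if k: "k \<in> carrier K" for k
    proof (rule inj[OF V(1) order_refl])
      show "\<phi> V (c (k \<odot>\<^bsub>?M\<^esub> v)) = \<phi> V (k \<odot>\<^bsub>sec E V\<^esub> c v)"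
        using lV(3)[OF k c(1)[OF v]] c(2)[OF v] c(2)[OF mM(2)[OF k v]]
        by (auto simp: const_sheaf_sel)
    qed (use c v k mM module_closed[OF module_V] in auto)
  qed
  have "bij_betw (\<lambda>v. germ Z E p V (c v)) (carrier ?M) (carrier (stalk Z E p))" if p: "p \<in> V" for p
  proof (rule bij_betwI')
    fix v assume v: "v \<in> carrier ?M"
    show "germ Z E p V (c v) \<in> carrier (stalk Z E p)"
      by (rule germ_in_stalk[OF V(1) p c(1)[OF v]])
    fix w assume w: "w \<in> carrier ?M"
    show "(germ Z E p V (c v) = germ Z E p V (c w)) = (v = w)"
    proof
      assume "germ Z E p V (c v) = germ Z E p V (c w)"
      then obtain W where W: "openin Z W" "p \<in> W" "W \<subseteq> V" "res E V W (c v) = res E V W (c w)"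
        by (rule germ_eqD[OF P V(1) c(1)[OF w] p]) auto
      then have "restrict (\<lambda>_\<in>V. v) W = restrict (\<lambda>_\<in>V. w) W"
        using nat[OF V(1) order_refl W(1,3)] c[OF v] c[OF w] by metis
      from fun_cong[OF this, of p] show "v = w" using W(2) p by simp
    qed simp
  next
    fix a assume "a \<in> carrier (stalk Z E p)"
    then obtain U s where U: "openin Z U" "p \<in> U" "s \<in> carrier (sec E U)" "a = germ Z E p U s"
      by (rule stalkE)
    define U' where "U' = U \<inter> V"
    have U': "openin Z U'" "U' \<subseteq> V" "U' \<subseteq> U" "p \<in> U'" using U V p by (auto simp: U'_def)
    define s' where "s' = res E U U' s"
    have s': "s' \<in> carrier (sec E U')" using res_closed[OF P U(1) U'(1,3) U(3)] by (simp add: s'_def)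
    have l: "\<phi> U' s' \<in> carrier (sec ?C U')" by (rule linear_mapsD(1)[OF lin[OF U'(1,2)] s'])
    obtain W v where W: "openin (subtopology Z V) W" "p \<in> W" "W \<subseteq> U'"
      and v: "v \<in> carrier ?M" "\<forall>y\<in>W. \<phi> U' s' y = v"
      by (rule const_sheaf_section_near[OF l U'(4)])
    then have W: "openin Z W" "p \<in> W" "W \<subseteq> U'" by (simp_all add: sub)
    note v = v(1) and v_eq = v(2)
    have WV: "W \<subseteq> V" using W U' by blast
    have "\<phi> W (res E U' W s') = \<phi> W (res E V W (c v))"
      using nat[OF U'(1,2) W(1,3) s'] nat[OF V(1) order_refl W(1) WV c(1)[OF v]] c(2)[OF v] v_eq WV
      by (auto simp: Int_absorb1 intro!: restrict_ext)
    then have "res E U' W s' = res E V W (c v)"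
      using inj[OF W(1) WV res_closed[OF P U'(1) W(1,3) s'] res_closed[OF P V(1) W(1) WV c(1)[OF v]]]
      by simp
    then have "germ Z E p U' s' = germ Z E p V (c v)"
      by (rule germ_eqI[OF P U'(1) s' V(1) c(1)[OF v] W(1,2,3) WV])
    then have "a = germ Z E p V (c v)"
      using germ_res[OF P U(1,3) U'(1,3,4)] U(4) by (simp add: s'_def)
    then show "\<exists>v\<in>carrier ?M. a = germ Z E p V (c v)" using v by blast
  qed
  then have "local_frame K Z E V n c" using V(1) clin by (simp add: local_frame_def)
  then show thesis using that V(2) by blast
qed

text \<open>
  A section agrees at \<open>y\<close> with a unique frame section, and then on a neighbourhood of \<open>y\<close> because
  equality of germs is open.
\<close>

lemma inv_image_section_local_frame:
  assumes E: "is_presheaf K Z E" and f: "continuous_map X Z f" and c: "local_frame K Z E V n c"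
    and s: "s \<in> carrier (sec (inv_image X Z f E) U)" and U: "openin X U" and y: "y \<in> U" "f y \<in> V"
  obtains W v where "openin X W" "y \<in> W" "W \<subseteq> U" "f ` W \<subseteq> V" "v \<in> carrier (coord_space K n)"
    "\<forall>q\<in>W. s q = germ Z E (f q) V (c v)"
proof -
  obtain W' V' t where 1: "openin X W'" "y \<in> W'" "W' \<subseteq> U" "openin Z V'" "f ` W' \<subseteq> V'"
    "t \<in> carrier (sec E V')" "\<forall>q\<in>W'. s q = germ Z E (f q) V' t"
    by (rule inv_image_section_near[OF s y(1)])
  obtain v where v: "v \<in> carrier (coord_space K n)" "s y = germ Z E (f y) V (c v)"
    by (rule local_frame_germ_surj[OF c y(2) inv_image_section_stalk[OF s y(1)]])
  have "germ Z E (f y) V' t = germ Z E (f y) V (c v)" using 1(2,7) v(2) by simp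
  then obtain N where N: "openin Z N" "f y \<in> N" "N \<subseteq> V'" "N \<subseteq> V"
    "\<forall>p\<in>N. germ Z E p V' t = germ Z E p V (c v)"
    by (rule germ_eq_near[OF E 1(4,6) local_frameD(1)[OF c] local_frameD(4)[OF c v(1)] y(2)])
  let ?W = "W' \<inter> {q \<in> topspace X. f q \<in> N}"
  have "openin X ?W" "y \<in> ?W" "?W \<subseteq> U" "f ` ?W \<subseteq> V"
    using 1(1-3) N openin_continuous_map_preimage[OF f N(1)] openin_subset[OF 1(1)] by auto
  then show thesis
    by (rule that[OF _ _ _ _ v(1)]) (use 1(7) N(5) in auto)
qed

text \<open>
  A frame of \<open>E\<close> near \<open>f x\<close> assigns coordinates to all germs at the points \<open>f y\<close> with \<open>y\<close> near \<open>x\<close>.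
  Reading sections of the inverse image in these coordinates identifies them with locally constant functions.
\<close>

lemma local_system_inv_image:
  assumes E: "local_system K Z E" and f: "continuous_map X Z f"
  shows "local_system K X (inv_image X Z f E)"
proof -
  let ?G = "inv_image X Z f E"
  have P: "is_presheaf K Z E" using E by (simp add: local_system_def is_sheaf_def)
  have cK: "cring K" using is_presheafD(1)[OF P openin_topspace] by (simp add: Module.module_def)
  have "\<exists>V n \<phi>. openin X V \<and> x \<in> V \<and>
      sheaf_iso K (subtopology X V) ?G (const_sheaf (subtopology X V) (coord_space K n)) \<phi>"
    if x: "x \<in> topspace X" for x
  proof -
    have "f x \<in> topspace Z" using continuous_map_image_subset_topspace[OF f] x by blast
    then obtain V n c where c: "local_frame K Z E V n c" and xV: "f x \<in> V"
      by (rule local_system_local_frame[OF E])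
    let ?M = "coord_space K n"
    define N where "N = {y \<in> topspace X. f y \<in> V}"
    have N: "openin X N" "x \<in> N"
      using openin_continuous_map_preimage[OF f local_frameD(1)[OF c]] x xV by (auto simp: N_def)
    let ?C = "const_sheaf (subtopology X N) ?M"
    have sub: "openin (subtopology X N) U \<longleftrightarrow> openin X U \<and> U \<subseteq> N" for U
      using openin_open_subtopology[OF N(1)] by auto
    \<comment> \<open>coordinates of germs with respect to the frame\<close>
    define \<tau> where "\<tau> p = inv_into (carrier ?M) (\<lambda>v. germ Z E p V (c v))" for p
    have \<tau>_germ: "\<tau> p (germ Z E p V (c v)) = v" if "p \<in> V" "v \<in> carrier ?M" for p v
      unfolding \<tau>_def
      by (rule inv_into_f_f[OF bij_betw_imp_inj_on[OF local_frameD(3)[OF c that(1)]] that(2)])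
    have \<tau>_inj: "a = b" if p: "p \<in> V" and a: "a \<in> carrier (stalk Z E p)"
      and b: "b \<in> carrier (stalk Z E p)" and "\<tau> p a = \<tau> p b" for p a b
      using local_frame_germ_surj[OF c p a] local_frame_germ_surj[OF c p b] \<tau>_germ[OF p] that(4) by metis
    have \<tau>_lin: "\<tau> p \<in> linear_maps K (stalk Z E p) ?M" if p: "p \<in> V" for p
      unfolding \<tau>_def
      by (rule linear_maps_inv_into[OF module_coord_space[OF cK] local_frame_germ_linear[OF P c p]
            local_frameD(3)[OF c p]])
    define \<phi> where "\<phi> U s = (\<lambda>y\<in>U. \<tau> (f y) (s y))" for U s
    have fN: "f y \<in> V" if "U \<subseteq> N" "y \<in> U" for U y using that by (auto simp: N_def)
    have \<phi>_sec: "\<phi> U s \<in> carrier (sec ?C U)"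
      if U: "openin X U" "U \<subseteq> N" and s: "s \<in> carrier (sec ?G U)" for U s
    proof -
      have "\<exists>W. openin (subtopology X N) W \<and> y \<in> W \<and> W \<subseteq> U \<and> (\<forall>q\<in>W. \<phi> U s q = \<phi> U s y)"
        if y: "y \<in> U" for y
      proof -
        obtain W v where W: "openin X W" "y \<in> W" "W \<subseteq> U" "f ` W \<subseteq> V" "v \<in> carrier ?M"
          "\<forall>q\<in>W. s q = germ Z E (f q) V (c v)"
          by (rule inv_image_section_local_frame[OF P f c s U(1) y fN[OF U(2) y]])
        have "\<phi> U s q = v" if "q \<in> W" for q
          using that W \<tau>_germ[of "f q" v] by (auto simp: \<phi>_def)
        then show ?thesis using W(1-3) U(2) by (intro exI[of _ W]) (auto simp: sub)
      qed
      moreover have "\<phi> U s \<in> U \<rightarrow>\<^sub>E carrier ?M"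
        using linear_mapsD(1)[OF \<tau>_lin[OF fN[OF U(2)]] inv_image_section_stalk[OF s]]
        by (auto simp: \<phi>_def)
      ultimately show ?thesis by (simp add: const_sheaf_sel)
    qed
    have "sheaf_hom K (subtopology X N) ?G ?C \<phi>"
      unfolding sheaf_hom_def
    proof (intro conjI allI impI ballI)
      fix U assume "openin (subtopology X N) U"
      then have U: "openin X U" "U \<subseteq> N" by (auto simp: sub)
      note st = inv_image_section_stalk[of _ X Z f E U]
      show "\<phi> U \<in> linear_maps K (sec ?G U) (sec ?C U)"
        using \<phi>_sec[OF U] linear_mapsD(2,3)[OF \<tau>_lin[OF fN[OF U(2)]]] st
        by (intro linear_mapsI) (auto simp: \<phi>_def const_sheaf_sel intro!: restrict_ext)
    next
      fix U W s
      show "\<phi> W (res ?G U W s) = res ?C U W (\<phi> U s)"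
        if "openin (subtopology X N) U \<and> openin (subtopology X N) W \<and> W \<subseteq> U"
        using that by (auto simp: \<phi>_def const_sheaf_sel Int_absorb1 intro!: restrict_ext)
    qed
    moreover have "bij_betw (\<phi> U) (carrier (sec ?G U)) (carrier (sec ?C U))"
      if "openin (subtopology X N) U" for U
    proof (rule bij_betwI')
      have U: "openin X U" "U \<subseteq> N" using that by (auto simp: sub)
      fix s assume s: "s \<in> carrier (sec ?G U)"
      show "\<phi> U s \<in> carrier (sec ?C U)" by (rule \<phi>_sec[OF U s])
      fix t assume t: "t \<in> carrier (sec ?G U)"
      show "(\<phi> U s = \<phi> U t) = (s = t)"
      proof
        assume eq: "\<phi> U s = \<phi> U t"
        show "s = t"
        proof (rule extensionalityI)
          show "s \<in> extensional U" "t \<in> extensional U"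
            using inv_image_section_extensional s t by blast+
          fix y assume y: "y \<in> U"
          have "\<tau> (f y) (s y) = \<tau> (f y) (t y)" using fun_cong[OF eq, of y] y by (simp add: \<phi>_def)
          then show "s y = t y"
            by (rule \<tau>_inj[OF fN[OF U(2) y] inv_image_section_stalk[OF s y]
                  inv_image_section_stalk[OF t y]])
        qed
      qed simp
    next
      have U: "openin X U" "U \<subseteq> N" using that by (auto simp: sub)
      fix l assume l: "l \<in> carrier (sec ?C U)"
      then have lM: "l \<in> U \<rightarrow>\<^sub>E carrier ?M" by (simp add: const_sheaf_sel)
      define s where "s = (\<lambda>y\<in>U. germ Z E (f y) V (c (l y)))"
      have "s \<in> carrier (sec ?G U)"
      proof (rule inv_image_sectionI[OF U(1)])
        show "s \<in> extensional U" by (simp add: s_def)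
        fix y assume y: "y \<in> U"
        obtain W v where W: "openin (subtopology X N) W" "y \<in> W" "W \<subseteq> U"
          and v: "v \<in> carrier ?M" "\<forall>q\<in>W. l q = v"
          by (rule const_sheaf_section_near[OF l y])
        show "\<exists>W V' t. openin X W \<and> y \<in> W \<and> openin Z V' \<and> t \<in> carrier (sec E V') \<and>
            (\<forall>q\<in>W \<inter> U. f q \<in> V' \<and> s q = germ Z E (f q) V' t)"
          using W v U fN[OF U(2)] local_frameD(1,4)[OF c]
          by (intro exI[of _ W] exI[of _ V] exI[of _ "c v"]) (auto simp: sub s_def)
      qed
      moreover have "l = \<phi> U s"
        using lM \<tau>_germ[OF fN[OF U(2)]]
        by (intro extensionalityI[of _ U]) (auto simp: \<phi>_def s_def PiE_iff)
      ultimately show "\<exists>s\<in>carrier (sec ?G U). l = \<phi> U s" by blast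
    qed
    ultimately show ?thesis
      using N by (auto simp: sheaf_iso_def)
  qed
  then show ?thesis
    using is_sheaf_inv_image[OF P f] by (simp add: local_system_def)
qed

section \<open>Parallel transport\<close>

text \<open>
  Near each point both sections are given by frame sections, which have equal germs either at all points of
  the frame or at none.  So the set where they agree is open together with its complement.
\<close>

lemma inv_image_section_unique:
  assumes E: "local_system K Z E" and f: "continuous_map X Z f" and X: "connected_space X"
    and s: "s \<in> carrier (sec (inv_image X Z f E) (topspace X))"
    and t: "t \<in> carrier (sec (inv_image X Z f E) (topspace X))"
    and x: "x \<in> topspace X" "s x = t x"
  shows "s = t"
proof (rule extensionalityI)
  have P: "is_presheaf K Z E" using E by (simp add: local_system_def is_sheaf_def)
  have near: "\<exists>W. openin X W \<and> y \<in> W \<and> (\<forall>q\<in>W. (s q = t q) = (s y = t y))"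
    if y: "y \<in> topspace X" for y
  proof -
    have "f y \<in> topspace Z" using continuous_map_image_subset_topspace[OF f] y by blast
    then obtain V n c where c: "local_frame K Z E V n c" "f y \<in> V"
      by (rule local_system_local_frame[OF E])
    obtain W v where W: "openin X W" "y \<in> W" "W \<subseteq> topspace X" "f ` W \<subseteq> V"
      "v \<in> carrier (coord_space K n)" "\<forall>q\<in>W. s q = germ Z E (f q) V (c v)"
      by (rule inv_image_section_local_frame[OF P f c(1) s openin_topspace y c(2)])
    obtain W' w where W': "openin X W'" "y \<in> W'" "W' \<subseteq> topspace X" "f ` W' \<subseteq> V"
      "w \<in> carrier (coord_space K n)" "\<forall>q\<in>W'. t q = germ Z E (f q) V (c w)"
      by (rule inv_image_section_local_frame[OF P f c(1) t openin_topspace y c(2)])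
    have "(s q = t q) = (v = w)" if q: "q \<in> W \<inter> W'" for q
    proof -
      have "f q \<in> V" using q W(4) by blast
      then show ?thesis using local_frame_germ_inj[OF c(1) _ W(5) W'(5)] W(6) W'(6) q by auto
    qed
    then show ?thesis using W(1,2) W'(1,2) by (intro exI[of _ "W \<inter> W'"]) auto
  qed
  define A where "A = {y \<in> topspace X. s y = t y}"
  have "openin X A"
  proof (subst openin_subopen, intro ballI)
    fix y assume y: "y \<in> A"
    then have y': "y \<in> topspace X" "s y = t y" by (auto simp: A_def)
    then obtain W where W: "openin X W" "y \<in> W" "\<forall>q\<in>W. s q = t q"
      using near[OF y'(1)] by blast
    then show "\<exists>W. openin X W \<and> y \<in> W \<and> W \<subseteq> A"
      using openin_subset[OF W(1)] by (intro exI[of _ W]) (auto simp: A_def)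
  qed
  moreover have "openin X (topspace X - A)"
  proof (subst openin_subopen, intro ballI)
    fix y assume y: "y \<in> topspace X - A"
    then have y': "y \<in> topspace X" "s y \<noteq> t y" by (auto simp: A_def)
    then obtain W where W: "openin X W" "y \<in> W" "\<forall>q\<in>W. s q \<noteq> t q"
      using near[OF y'(1)] by blast
    then show "\<exists>W. openin X W \<and> y \<in> W \<and> W \<subseteq> topspace X - A"
      using openin_subset[OF W(1)] by (intro exI[of _ W]) (auto simp: A_def)
  qed
  ultimately have "A = {} \<or> A = topspace X"
    using X by (auto simp: connected_space_clopen_in closedin_def A_def)
  then have "A = topspace X" using x by (auto simp: A_def)
  then show "s y = t y" if "y \<in> topspace X" for y using that by (auto simp: A_def)
  show "s \<in> extensional (topspace X)" "t \<in> extensional (topspace X)"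
    using inv_image_section_extensional s t by blast+
qed

lemma inv_image_section_cong:
  assumes s: "s \<in> carrier (sec (inv_image X Z f E) U)" and U: "openin X U"
    and fg: "\<forall>y\<in>U. f y = g y"
  shows "s \<in> carrier (sec (inv_image X Z g E) U)"
proof (rule inv_image_sectionI[OF U inv_image_section_extensional[OF s]])
  fix x assume "x \<in> U"
  then obtain W V t where W: "openin X W" "x \<in> W" "W \<subseteq> U" "openin Z V" "f ` W \<subseteq> V"
    "t \<in> carrier (sec E V)" "\<forall>y\<in>W. s y = germ Z E (f y) V t"
    by (rule inv_image_section_near[OF s])
  have "\<forall>y\<in>W \<inter> U. g y \<in> V \<and> s y = germ Z E (g y) V t"
    using W(5,7) fg by (metis IntE image_subset_iff)
  then show "\<exists>W V t. openin X W \<and> x \<in> W \<and> openin Z V \<and> t \<in> carrier (sec E V) \<and>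
      (\<forall>y\<in>W \<inter> U. g y \<in> V \<and> s y = germ Z E (g y) V t)"
    using W by blast
qed

text \<open>
  For the flip of the unit interval this turns sections along a path into sections along the reversed path.
\<close>

lemma inv_image_section_pullback:
  assumes s: "s \<in> carrier (sec (inv_image X Z f E) (topspace X))" and r: "continuous_map Y X r"
  shows "(\<lambda>y\<in>topspace Y. s (r y)) \<in> carrier (sec (inv_image Y Z (\<lambda>y. f (r y)) E) (topspace Y))"
proof (rule inv_image_sectionI[OF openin_topspace restrict_extensional])
  fix y assume y: "y \<in> topspace Y"
  then have "r y \<in> topspace X" using continuous_map_image_subset_topspace[OF r] by blast
  then obtain W V t where W: "openin X W" "r y \<in> W" "W \<subseteq> topspace X" "openin Z V" "f ` W \<subseteq> V"
    "t \<in> carrier (sec E V)" "\<forall>q\<in>W. s q = germ Z E (f q) V t"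
    by (rule inv_image_section_near[OF s])
  show "\<exists>W V t. openin Y W \<and> y \<in> W \<and> openin Z V \<and> t \<in> carrier (sec E V) \<and>
      (\<forall>q\<in>W \<inter> topspace Y. f (r q) \<in> V \<and>
        (\<lambda>y\<in>topspace Y. s (r y)) q = germ Z E (f (r q)) V t)"
    using W y openin_continuous_map_preimage[OF r W(1)]
    by (intro exI[of _ "{q \<in> topspace Y. r q \<in> W}"] exI[of _ V] exI[of _ t]) auto
qed

abbreviation (input) unit_interval :: "real topology" where
  "unit_interval \<equiv> top_of_set {0..1}"

abbreviation (input) path_sections :: "'z topology \<Rightarrow> (real \<Rightarrow> 'z) \<Rightarrow> ('k, 'z, 's) presheaf \<Rightarrow>
    (real \<Rightarrow> ('z set \<times> 's) set) set" where
  "path_sections Z \<gamma> E \<equiv> carrier (sec (inv_image unit_interval Z \<gamma> E) {0..1})"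

lemma open_unit_interval: "openin unit_interval {0..1}"
  using openin_topspace[of unit_interval] by simp

lemma path_section_unique:
  assumes E: "local_system K Z E" and \<gamma>: "continuous_map unit_interval Z \<gamma>"
    and s: "s \<in> path_sections Z \<gamma> E" and t: "t \<in> path_sections Z \<gamma> E" and "s 0 = t 0"
  shows "s = t"
proof (rule inv_image_section_unique[OF E \<gamma>])
  show "connected_space unit_interval"
    by (simp add: connected_space_subtopology connectedin_iff_connected)
qed (use assms in auto)

text \<open>
  Since \<open>[0,1]\<close> is connected, a section is determined by its value at \<open>0\<close>; hence the choice of a
  preimage in the definition of the transport is forced.
\<close>

lemma path_transport_section:
  assumes E: "local_system K Z E" and \<gamma>: "continuous_map unit_interval Z \<gamma>"
    and s: "s \<in> path_sections Z \<gamma> E"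
  shows "path_transport Z \<gamma> E (s 0) = s 1"
proof -
  have "inj_on (\<lambda>s. s 0) (path_sections Z \<gamma> E)"
    using path_section_unique[OF E \<gamma>] by (auto intro: inj_onI)
  then show ?thesis
    using inv_into_f_f[of "\<lambda>s. s 0" _ s] s by (simp add: path_transport_def)
qed

lemma path_transport_cong:
  assumes "\<forall>t\<in>{0..1}. \<gamma> t = \<delta> t"
  shows "path_transport Z \<gamma> E = path_transport Z \<delta> E"
proof -
  have "path_sections Z \<gamma> E = path_sections Z \<delta> E"
    using inv_image_section_cong[OF _ open_unit_interval, of _ Z \<gamma> E \<delta>]
      inv_image_section_cong[OF _ open_unit_interval, of _ Z \<delta> E \<gamma>] assms by auto
  then show ?thesis by (intro ext) (simp only: path_transport_def)
qed

text \<open>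
  Sections of the inverse image of \<open>E\<close> along \<open>\<gamma>\<close> over \<open>[a,b]\<close>, without the requirement of
  being undefined outside the interval.  The metric form makes it easy to concatenate them.
\<close>

definition horizontal ::
  "'z topology \<Rightarrow> ('k, 'z, 's) presheaf \<Rightarrow> (real \<Rightarrow> 'z) \<Rightarrow> real \<Rightarrow> real \<Rightarrow>
   (real \<Rightarrow> ('z set \<times> 's) set) \<Rightarrow> bool" where
  "horizontal Z E \<gamma> a b \<sigma> \<longleftrightarrow> (\<forall>u\<in>{a..b}. \<exists>d>0. \<exists>V t. openin Z V \<and> t \<in> carrier (sec E V) \<and>
     (\<forall>w\<in>{a..b}. \<bar>w - u\<bar> < d \<longrightarrow> \<gamma> w \<in> V \<and> \<sigma> w = germ Z E (\<gamma> w) V t))"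

lemma horizontalE:
  assumes "horizontal Z E \<gamma> a b \<sigma>" "a \<le> u" "u \<le> b"
  obtains d V t where "d > 0" "openin Z V" "t \<in> carrier (sec E V)"
    "\<forall>w\<in>{a..b}. \<bar>w - u\<bar> < d \<longrightarrow> \<gamma> w \<in> V \<and> \<sigma> w = germ Z E (\<gamma> w) V t"
proof -
  have "u \<in> {a..b}" using assms(2,3) by simp
  then show thesis using assms(1) that unfolding horizontal_def by blast
qed

lemma unit_interval_radius:
  assumes "openin unit_interval J" "u \<in> J"
  obtains d where "d > 0" "\<forall>w\<in>{0..1}. \<bar>w - u\<bar> < d \<longrightarrow> w \<in> J"
  using assms unfolding openin_euclidean_subtopology_iff dist_real_def by blast

lemma horizontal_path_section:
  assumes "horizontal Z E \<gamma> 0 1 \<sigma>"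
  shows "restrict \<sigma> {0..1} \<in> path_sections Z \<gamma> E"
proof (rule inv_image_sectionI[OF open_unit_interval restrict_extensional])
  fix u :: real assume u: "u \<in> {0..1}"
  then obtain d V t where d: "d > 0" and V: "openin Z V" "t \<in> carrier (sec E V)"
    "\<forall>w\<in>{0..1}. \<bar>w - u\<bar> < d \<longrightarrow> \<gamma> w \<in> V \<and> \<sigma> w = germ Z E (\<gamma> w) V t"
    using horizontalE[OF assms, of u] by auto
  have "openin unit_interval ({0..1} \<inter> ball u d)" by (rule openin_open_Int) simp
  then show "\<exists>W V t. openin unit_interval W \<and> u \<in> W \<and> openin Z V \<and> t \<in> carrier (sec E V) \<and>
      (\<forall>w\<in>W \<inter> {0..1}. \<gamma> w \<in> V \<and> restrict \<sigma> {0..1} w = germ Z E (\<gamma> w) V t)"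
    using u d V
    by (intro exI[of _ "{0..1} \<inter> ball u d"] exI[of _ V] exI[of _ t])
      (auto simp: dist_real_def abs_minus_commute)
qed

text \<open>
  Only the common end point \<open>b\<close> needs an argument.  The sections of \<open>E\<close> that induce the two pieces
  there have the same germ at \<open>\<gamma> b\<close>, so near \<open>b\<close> the first of them induces both pieces.
\<close>

lemma horizontal_join:
  assumes E: "is_presheaf K Z E" and \<gamma>: "continuous_map unit_interval Z \<gamma>"
    and abc: "0 \<le> a" "a \<le> b" "b \<le> c" "c \<le> 1"
    and \<sigma>: "horizontal Z E \<gamma> a b \<sigma>" and \<rho>: "horizontal Z E \<gamma> b c \<rho>" and eq: "\<sigma> b = \<rho> b"
  shows "horizontal Z E \<gamma> a c (\<lambda>u. if u \<le> b then \<sigma> u else \<rho> u)"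
  unfolding horizontal_def
proof
  fix u assume u: "u \<in> {a..c}"
  show "\<exists>d>0. \<exists>V t. openin Z V \<and> t \<in> carrier (sec E V) \<and> (\<forall>w\<in>{a..c}. \<bar>w - u\<bar> < d \<longrightarrow>
      \<gamma> w \<in> V \<and> (if w \<le> b then \<sigma> w else \<rho> w) = germ Z E (\<gamma> w) V t)"
  proof (cases u b rule: linorder_cases)
    case less
    then obtain d V t where "d > 0" "openin Z V" "t \<in> carrier (sec E V)"
      "\<forall>w\<in>{a..b}. \<bar>w - u\<bar> < d \<longrightarrow> \<gamma> w \<in> V \<and> \<sigma> w = germ Z E (\<gamma> w) V t"
      using horizontalE[OF \<sigma>, of u] u by auto
    then show ?thesis
      using less by (intro exI[of _ "min d (b - u)"] exI[of _ V] exI[of _ t] conjI) auto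
  next
    case greater
    then obtain d V t where "d > 0" "openin Z V" "t \<in> carrier (sec E V)"
      "\<forall>w\<in>{b..c}. \<bar>w - u\<bar> < d \<longrightarrow> \<gamma> w \<in> V \<and> \<rho> w = germ Z E (\<gamma> w) V t"
      using horizontalE[OF \<rho>, of u] u by auto
    then show ?thesis
      using greater by (intro exI[of _ "min d (u - b)"] exI[of _ V] exI[of _ t] conjI) auto
  next
    case equal
    obtain d V t where 1: "d > 0" "openin Z V" "t \<in> carrier (sec E V)"
      "\<forall>w\<in>{a..b}. \<bar>w - b\<bar> < d \<longrightarrow> \<gamma> w \<in> V \<and> \<sigma> w = germ Z E (\<gamma> w) V t"
      using horizontalE[OF \<sigma> abc(2) order_refl] .
    obtain d' V' t' where 2: "d' > 0" "openin Z V'" "t' \<in> carrier (sec E V')"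
      "\<forall>w\<in>{b..c}. \<bar>w - b\<bar> < d' \<longrightarrow> \<gamma> w \<in> V' \<and> \<rho> w = germ Z E (\<gamma> w) V' t'"
      using horizontalE[OF \<rho> order_refl abc(3)] .
    have "\<gamma> b \<in> V'" "germ Z E (\<gamma> b) V t = germ Z E (\<gamma> b) V' t'"
      using bspec[OF 1(4), of b] bspec[OF 2(4), of b] 1(1) 2(1) abc eq by auto
    then obtain N where N: "openin Z N" "\<gamma> b \<in> N" "N \<subseteq> V" "N \<subseteq> V'"
      "\<forall>p\<in>N. germ Z E p V t = germ Z E p V' t'"
      by (rule germ_eq_near[OF E 1(2,3) 2(2,3)])
    let ?J = "{w \<in> topspace unit_interval. \<gamma> w \<in> N}"
    have J: "openin unit_interval ?J" "b \<in> ?J"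
      using openin_continuous_map_preimage[OF \<gamma> N(1)] N(2) abc by auto
    obtain e where e: "e > 0" "\<forall>w\<in>{0..1}. \<bar>w - b\<bar> < e \<longrightarrow> w \<in> ?J"
      using unit_interval_radius[OF J] .
    have "\<gamma> w \<in> V \<and> (if w \<le> b then \<sigma> w else \<rho> w) = germ Z E (\<gamma> w) V t"
      if w: "w \<in> {a..c}" "\<bar>w - u\<bar> < min e (min d d')" for w
    proof -
      have "\<gamma> w \<in> N" using bspec[OF e(2), of w] w abc equal by auto
      then show ?thesis using bspec[OF 1(4), of w] bspec[OF 2(4), of w] N w equal by auto
    qed
    then show ?thesis
      using 1(1-3) 2(1) e(1)
      by (intro exI[of _ "min e (min d d')"] exI[of _ V] exI[of _ t] conjI ballI impI) auto
  qed
qed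

lemma homotopy_slices:
  assumes H: "continuous_map (prod_topology X unit_interval) Z H"
  shows "u \<in> {0..1} \<Longrightarrow> continuous_map X Z (\<lambda>y. H (y, u))"
    and "y \<in> topspace X \<Longrightarrow> continuous_map unit_interval Z (\<lambda>u. H (y, u))"
proof -
  show "continuous_map X Z (\<lambda>y. H (y, u))" if "u \<in> {0..1}"
  proof -
    have "continuous_map X (prod_topology X unit_interval) (\<lambda>y. (y, u))"
      using that by (auto intro!: continuous_map_pairedI)
    from continuous_map_compose[OF this H] show ?thesis by (simp add: o_def)
  qed
  show "continuous_map unit_interval Z (\<lambda>u. H (y, u))" if "y \<in> topspace X"
  proof -
    have "continuous_map unit_interval (prod_topology X unit_interval) (\<lambda>u. (y, u))"
      using that by (auto intro!: continuous_map_pairedI)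
    from continuous_map_compose[OF this H] show ?thesis by (simp add: o_def)
  qed
qed

text \<open>
  Parallel transport along the paths \<open>t \<mapsto> H (y, t)\<close> is continuous in \<open>y\<close>: germs induced by a single
  section at the starting points are carried to germs induced by a single section at the end points, for all
  \<open>y\<close> near \<open>x\<close>.  The argument is a bisection of \<open>[0,1]\<close>.  Composing intervals intersects the two
  neighbourhoods of \<open>x\<close> and joins the paths; over a short interval the homotopy maps a
  neighbourhood of \<open>x\<close> into the domain of one frame, where transport keeps the frame section fixed.
\<close>

lemma horizontal_continuation:
  assumes E: "local_system K Z E" and H: "continuous_map (prod_topology X unit_interval) Z H"
    and x: "x \<in> topspace X" and V: "openin Z V" "H (x, 0) \<in> V" and t: "t \<in> carrier (sec E V)"
  obtains W V' t' where "openin X W" "x \<in> W" "openin Z V'" "t' \<in> carrier (sec E V')"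
    "\<forall>y\<in>W. H (y, 0) \<in> V \<and> H (y, 1) \<in> V' \<and>
      (\<exists>\<sigma>\<in>path_sections Z (\<lambda>u. H (y, u)) E.
        \<sigma> 0 = germ Z E (H (y, 0)) V t \<and> \<sigma> 1 = germ Z E (H (y, 1)) V' t')"
proof -
  have P: "is_presheaf K Z E" using E by (simp add: local_system_def is_sheaf_def)
  \<comment> \<open>The bounds on \<open>a\<close> and \<open>b\<close> are a premise, since the local step ranges over all short intervals around a point, including those that leave \<open>[0,1]\<close>.\<close>
  define Q where "Q a b \<longleftrightarrow> (0 \<le> a \<and> b \<le> 1 \<longrightarrow> (\<forall>V t. openin Z V \<and> t \<in> carrier (sec E V) \<and>
    H (x, a) \<in> V \<longrightarrow> (\<exists>W V' t'. openin X W \<and> x \<in> W \<and> openin Z V' \<and> t' \<in> carrier (sec E V') \<and>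
      (\<forall>y\<in>W. H (y, a) \<in> V \<and> H (y, b) \<in> V' \<and> (\<exists>\<sigma>. horizontal Z E (\<lambda>u. H (y, u)) a b \<sigma> \<and>
        \<sigma> a = germ Z E (H (y, a)) V t \<and> \<sigma> b = germ Z E (H (y, b)) V' t')))))" for a b :: real
  have "Q 0 1" using zero_le_one
  proof (induction rule: Bolzano)
    case (trans a b c)
    show ?case
      unfolding Q_def
    proof (intro impI allI)
      fix V t assume ac: "0 \<le> a \<and> c \<le> 1"
        and V: "openin Z V \<and> t \<in> carrier (sec E V) \<and> H (x, a) \<in> V"
      obtain W V1 t1 where 1: "openin X W" "x \<in> W" "openin Z V1" "t1 \<in> carrier (sec E V1)"
        "\<forall>y\<in>W. H (y, a) \<in> V \<and> H (y, b) \<in> V1 \<and> (\<exists>\<sigma>. horizontal Z E (\<lambda>u. H (y, u)) a b \<sigma> \<and>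
          \<sigma> a = germ Z E (H (y, a)) V t \<and> \<sigma> b = germ Z E (H (y, b)) V1 t1)"
        using trans(1)[unfolded Q_def, rule_format, OF _ V] ac trans(3,4) by auto
      have V1: "openin Z V1 \<and> t1 \<in> carrier (sec E V1) \<and> H (x, b) \<in> V1" using 1 by blast
      obtain W' V2 t2 where 2: "openin X W'" "x \<in> W'" "openin Z V2" "t2 \<in> carrier (sec E V2)"
        "\<forall>y\<in>W'. H (y, b) \<in> V1 \<and> H (y, c) \<in> V2 \<and> (\<exists>\<sigma>. horizontal Z E (\<lambda>u. H (y, u)) b c \<sigma> \<and>
          \<sigma> b = germ Z E (H (y, b)) V1 t1 \<and> \<sigma> c = germ Z E (H (y, c)) V2 t2)"
        using trans(2)[unfolded Q_def, rule_format, OF _ V1] ac trans(3,4) by auto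
      have "H (y, a) \<in> V \<and> H (y, c) \<in> V2 \<and> (\<exists>\<sigma>. horizontal Z E (\<lambda>u. H (y, u)) a c \<sigma> \<and>
          \<sigma> a = germ Z E (H (y, a)) V t \<and> \<sigma> c = germ Z E (H (y, c)) V2 t2)"
        if y: "y \<in> W \<inter> W'" for y
      proof -
        obtain \<sigma> where \<sigma>: "horizontal Z E (\<lambda>u. H (y, u)) a b \<sigma>"
          "\<sigma> a = germ Z E (H (y, a)) V t" "\<sigma> b = germ Z E (H (y, b)) V1 t1"
          using 1(5) y by blast
        obtain \<rho> where \<rho>: "horizontal Z E (\<lambda>u. H (y, u)) b c \<rho>"
          "\<rho> b = germ Z E (H (y, b)) V1 t1" "\<rho> c = germ Z E (H (y, c)) V2 t2"
          using 2(5) y by blast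
        have "y \<in> topspace X" using y openin_subset[OF 1(1)] by blast
        then have "horizontal Z E (\<lambda>u. H (y, u)) a c (\<lambda>u. if u \<le> b then \<sigma> u else \<rho> u)"
          using ac trans(3,4) \<sigma> \<rho>
          by (intro horizontal_join[OF P homotopy_slices(2)[OF H]]) auto
        moreover have "(if a \<le> b then \<sigma> a else \<rho> a) = germ Z E (H (y, a)) V t"
          using trans(3) \<sigma>(2) by simp
        moreover have "(if c \<le> b then \<sigma> c else \<rho> c) = germ Z E (H (y, c)) V2 t2"
          using trans(4) \<sigma>(3) \<rho>(2,3) by (cases "c = b") auto
        ultimately show ?thesis using 1(5) 2(5) y by blast
      qed
      then show "\<exists>W V' t'. openin X W \<and> x \<in> W \<and> openin Z V' \<and> t' \<in> carrier (sec E V') \<and>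
        (\<forall>y\<in>W. H (y, a) \<in> V \<and> H (y, c) \<in> V' \<and> (\<exists>\<sigma>. horizontal Z E (\<lambda>u. H (y, u)) a c \<sigma> \<and>
        \<sigma> a = germ Z E (H (y, a)) V t \<and> \<sigma> c = germ Z E (H (y, c)) V' t'))"
        using 1(1,2) 2(1-4) by (intro exI[of _ "W \<inter> W'"] exI[of _ V2] exI[of _ t2]) blast
    qed
  next
    case (local r)
    have "H (x, r) \<in> topspace Z"
      using continuous_map_image_subset_topspace[OF H] x local by force
    then obtain N n c where c: "local_frame K Z E N n c" "H (x, r) \<in> N"
      by (rule local_system_local_frame[OF E])
    let ?S = "{p \<in> topspace (prod_topology X unit_interval). H p \<in> N}"
    have S: "openin (prod_topology X unit_interval) ?S" "(x, r) \<in> ?S"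
      using openin_continuous_map_preimage[OF H local_frameD(1)[OF c(1)]] c(2) x local by auto
    from openin_prod_topology_alt[THEN iffD1, rule_format, OF this]
    obtain W0 J where W0: "openin X W0" "openin unit_interval J" "x \<in> W0" "r \<in> J"
      "W0 \<times> J \<subseteq> ?S"
      by blast
    obtain d where d: "d > 0" "\<forall>w\<in>{0..1}. \<bar>w - r\<bar> < d \<longrightarrow> w \<in> J"
      using unit_interval_radius[OF W0(2,4)] .
    have "Q a b" if ab: "a \<le> r \<and> r \<le> b \<and> b - a < d" for a b
      unfolding Q_def
    proof (intro impI allI)
      fix V t assume I: "0 \<le> a \<and> b \<le> 1"
        and V: "openin Z V \<and> t \<in> carrier (sec E V) \<and> H (x, a) \<in> V"
      have N: "H (y, u) \<in> N" if "y \<in> W0" "a \<le> u" "u \<le> b" for y u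
        using bspec[OF d(2), of u] W0(5) that ab I by auto
      have "germ Z E (H (x, a)) V t \<in> carrier (stalk Z E (H (x, a)))"
        using V by (auto intro: germ_in_stalk)
      then obtain v where v: "v \<in> carrier (coord_space K n)"
        "germ Z E (H (x, a)) V t = germ Z E (H (x, a)) N (c v)"
        using local_frame_germ_surj[OF c(1) N[OF W0(3)], of a] ab by auto
      have xN: "H (x, a) \<in> N" using N[OF W0(3), of a] ab by simp
      have V0: "openin Z V" "t \<in> carrier (sec E V)" using V by auto
      obtain M where M: "openin Z M" "H (x, a) \<in> M" "M \<subseteq> V" "M \<subseteq> N"
        "\<forall>p\<in>M. germ Z E p V t = germ Z E p N (c v)"
        by (rule germ_eq_near[OF P V0 local_frameD(1)[OF c(1)] local_frameD(4)[OF c(1) v(1)] xN v(2)])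
      have "a \<in> {0..1}" using I ab by auto
      note Ha = homotopy_slices(1)[OF H this]
      define W where "W = W0 \<inter> {y \<in> topspace X. H (y, a) \<in> M}"
      have W: "openin X W" "x \<in> W"
        using W0(1,3) openin_continuous_map_preimage[OF Ha M(1)] M(2) x by (auto simp: W_def)
      have "H (y, a) \<in> V \<and> H (y, b) \<in> N \<and> (\<exists>\<sigma>. horizontal Z E (\<lambda>u. H (y, u)) a b \<sigma> \<and>
          \<sigma> a = germ Z E (H (y, a)) V t \<and> \<sigma> b = germ Z E (H (y, b)) N (c v))" if y: "y \<in> W" for y
      proof -
        have yW: "y \<in> W0" "H (y, a) \<in> M" using y by (auto simp: W_def)
        have "horizontal Z E (\<lambda>u. H (y, u)) a b (\<lambda>u. germ Z E (H (y, u)) N (c v))"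
          unfolding horizontal_def
          using N[OF yW(1)] local_frameD(1)[OF c(1)] local_frameD(4)[OF c(1) v(1)]
          by (intro ballI exI[of _ 1] exI[of _ N] exI[of _ "c v"] conjI impI) auto
        moreover have "H (y, a) \<in> V" "germ Z E (H (y, a)) N (c v) = germ Z E (H (y, a)) V t"
          using M yW by auto
        moreover have "H (y, b) \<in> N" using N[OF yW(1), of b] ab by simp
        ultimately show ?thesis by blast
      qed
      then show "\<exists>W V' t'. openin X W \<and> x \<in> W \<and> openin Z V' \<and> t' \<in> carrier (sec E V') \<and>
        (\<forall>y\<in>W. H (y, a) \<in> V \<and> H (y, b) \<in> V' \<and> (\<exists>\<sigma>. horizontal Z E (\<lambda>u. H (y, u)) a b \<sigma> \<and>
        \<sigma> a = germ Z E (H (y, a)) V t \<and> \<sigma> b = germ Z E (H (y, b)) V' t'))"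
        using W local_frameD(1)[OF c(1)] local_frameD(4)[OF c(1) v(1)]
        by (intro exI[of _ W] exI[of _ N] exI[of _ "c v"]) blast
    qed
    then show ?case using d(1) by blast
  qed
  then obtain W V' t' where W: "openin X W" "x \<in> W" "openin Z V'" "t' \<in> carrier (sec E V')"
    "\<forall>y\<in>W. H (y, 0) \<in> V \<and> H (y, 1) \<in> V' \<and> (\<exists>\<sigma>. horizontal Z E (\<lambda>u. H (y, u)) 0 1 \<sigma> \<and>
      \<sigma> 0 = germ Z E (H (y, 0)) V t \<and> \<sigma> 1 = germ Z E (H (y, 1)) V' t')"
    unfolding Q_def using V t by (metis order_refl)
  show thesis
  proof (rule that[OF W(1-4)], intro ballI conjI)
    fix y assume y: "y \<in> W"
    show "H (y, 0) \<in> V" "H (y, 1) \<in> V'" using W(5) y by blast+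
    obtain \<sigma> where \<sigma>: "horizontal Z E (\<lambda>u. H (y, u)) 0 1 \<sigma>"
      "\<sigma> 0 = germ Z E (H (y, 0)) V t" "\<sigma> 1 = germ Z E (H (y, 1)) V' t'"
      using W(5) y by blast
    show "\<exists>\<sigma>\<in>path_sections Z (\<lambda>u. H (y, u)) E.
        \<sigma> 0 = germ Z E (H (y, 0)) V t \<and> \<sigma> 1 = germ Z E (H (y, 1)) V' t'"
      using horizontal_path_section[OF \<sigma>(1)] \<sigma>(2,3) by (intro bexI) auto
  qed
qed

text \<open>
  A single path is a homotopy that is constant in the parameter.
\<close>

lemma path_section_exists:
  assumes E: "local_system K Z E" and \<gamma>: "continuous_map unit_interval Z \<gamma>"
    and a: "a \<in> carrier (stalk Z E (\<gamma> 0))"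
  obtains \<sigma> where "\<sigma> \<in> path_sections Z \<gamma> E" "\<sigma> 0 = a"
proof -
  obtain V t where V: "openin Z V" "\<gamma> 0 \<in> V" "t \<in> carrier (sec E V)" "a = germ Z E (\<gamma> 0) V t"
    using a by (rule stalkE)
  \<comment> \<open>Any space with a point could serve as the parameter space; here it is the unit interval with the point \<open>0\<close>.\<close>
  have "continuous_map (prod_topology unit_interval unit_interval) Z (\<gamma> \<circ> snd)"
    by (rule continuous_map_compose[OF continuous_map_snd \<gamma>])
  then obtain W V' t' where "(0::real) \<in> W" "\<forall>y\<in>W. (\<gamma> \<circ> snd) (y, 0) \<in> V \<and> (\<gamma> \<circ> snd) (y, 1) \<in> V' \<and>
      (\<exists>\<sigma>\<in>path_sections Z (\<lambda>u. (\<gamma> \<circ> snd) (y, u)) E.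
        \<sigma> 0 = germ Z E ((\<gamma> \<circ> snd) (y, 0)) V t \<and> \<sigma> 1 = germ Z E ((\<gamma> \<circ> snd) (y, 1)) V' t')"
    using V by (elim horizontal_continuation[OF E, of unit_interval "\<gamma> \<circ> snd" 0 V t]) auto
  then show thesis using that V(4) by auto
qed

lemma linear_path_transport:
  assumes E: "local_system K Z E" and \<gamma>: "continuous_map unit_interval Z \<gamma>"
  shows "path_transport Z \<gamma> E \<in> linear_maps K (stalk Z E (\<gamma> 0)) (stalk Z E (\<gamma> 1))"
proof (rule linear_mapsI)
  have P: "is_presheaf K Z E" using E by (simp add: local_system_def is_sheaf_def)
  note T = path_transport_section[OF E \<gamma>]
  fix a assume "a \<in> carrier (stalk Z E (\<gamma> 0))"
  then obtain s where s: "s \<in> path_sections Z \<gamma> E" "s 0 = a"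
    by (rule path_section_exists[OF E \<gamma>])
  show "path_transport Z \<gamma> E a \<in> carrier (stalk Z E (\<gamma> 1))"
    using T[OF s(1)] s(2) inv_image_section_stalk[OF s(1), of 1] by simp
  show "path_transport Z \<gamma> E (c \<odot>\<^bsub>stalk Z E (\<gamma> 0)\<^esub> a) =
      c \<odot>\<^bsub>stalk Z E (\<gamma> 1)\<^esub> path_transport Z \<gamma> E a" if c: "c \<in> carrier K" for c
    using T[OF s(1)] s(2) T[OF inv_image_section_smult[OF P open_unit_interval c s(1)]] by simp
  fix b assume "b \<in> carrier (stalk Z E (\<gamma> 0))"
  then obtain t where t: "t \<in> path_sections Z \<gamma> E" "t 0 = b"
    by (rule path_section_exists[OF E \<gamma>])
  show "path_transport Z \<gamma> E (a \<oplus>\<^bsub>stalk Z E (\<gamma> 0)\<^esub> b) =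
      path_transport Z \<gamma> E a \<oplus>\<^bsub>stalk Z E (\<gamma> 1)\<^esub> path_transport Z \<gamma> E b"
    using T[OF s(1)] s(2) T[OF t(1)] t(2)
      T[OF inv_image_section_add[OF P open_unit_interval s(1) t(1)]] by simp
qed

text \<open>
  A germ at the end point is continued along the reversed path.
\<close>

lemma path_transport_surj:
  assumes E: "local_system K Z E" and \<gamma>: "continuous_map unit_interval Z \<gamma>"
  shows "path_transport Z \<gamma> E ` carrier (stalk Z E (\<gamma> 0)) = carrier (stalk Z E (\<gamma> 1))"
proof
  show "path_transport Z \<gamma> E ` carrier (stalk Z E (\<gamma> 0)) \<subseteq> carrier (stalk Z E (\<gamma> 1))"
    using linear_mapsD(1)[OF linear_path_transport[OF E \<gamma>]] by blast
  show "carrier (stalk Z E (\<gamma> 1)) \<subseteq> path_transport Z \<gamma> E ` carrier (stalk Z E (\<gamma> 0))"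
  proof
    fix b assume b: "b \<in> carrier (stalk Z E (\<gamma> 1))"
    have r: "continuous_map unit_interval unit_interval (\<lambda>u. 1 - u)"
      by (auto intro!: continuous_intros)
    have "continuous_map unit_interval Z (\<lambda>u. \<gamma> (1 - u))"
      using continuous_map_compose[OF r \<gamma>] by (simp add: o_def)
    then obtain \<sigma> where \<sigma>: "\<sigma> \<in> path_sections Z (\<lambda>u. \<gamma> (1 - u)) E" "\<sigma> 0 = b"
      using b by (elim path_section_exists[OF E]) auto
    define s where "s = (\<lambda>u\<in>{0..1}. \<sigma> (1 - u))"
    have s: "s \<in> path_sections Z \<gamma> E"
      using inv_image_section_pullback[OF _ r, of \<sigma> Z "\<lambda>u. \<gamma> (1 - u)" E] \<sigma>(1) by (simp add: s_def)
    have "path_transport Z \<gamma> E (s 0) = b"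
      using path_transport_section[OF E \<gamma> s] \<sigma>(2) by (simp add: s_def)
    then show "b \<in> path_transport Z \<gamma> E ` carrier (stalk Z E (\<gamma> 0))"
      using inv_image_section_stalk[OF s, of 0] by auto
  qed
qed

section \<open>Homotopies act by a morphism of local systems\<close>

lemma stalk_map_germ:
  assumes F: "is_presheaf K X F" and G: "is_presheaf K X G" and \<phi>: "sheaf_hom K X F G \<phi>"
    and U: "openin X U" "x \<in> U" and s: "s \<in> carrier (sec F U)"
  shows "stalk_map X G x \<phi> (germ X F x U s) = germ X G x U (\<phi> U s)"
proof -
  have closed: "\<phi> V t \<in> carrier (sec G V)" if "openin X V" "t \<in> carrier (sec F V)" for V t
    using \<phi> that linear_mapsD(1) unfolding sheaf_hom_def by metis
  have nat: "\<phi> W (res F V W t) = res G V W (\<phi> V t)"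
    if "openin X V" "openin X W" "W \<subseteq> V" "t \<in> carrier (sec F V)" for V W t
    using \<phi> that unfolding sheaf_hom_def by blast
  have "germ X G x V (\<phi> V t) = germ X G x U (\<phi> U s)" if Vt: "(V, t) \<in> germ X F x U s" for V t
  proof -
    obtain W where V: "openin X V" "t \<in> carrier (sec F V)"
      and W: "openin X W" "x \<in> W" "W \<subseteq> V" "W \<subseteq> U" "res F U W s = res F V W t"
      using Vt by (auto simp: mem_germ_iff)
    have "res G V W (\<phi> V t) = res G U W (\<phi> U s)"
      using nat[OF V(1) W(1,3) V(2)] nat[OF U(1) W(1,4) s] W(5) by simp
    then show ?thesis
      by (rule germ_eqI[OF G V(1) closed[OF V] U(1) closed[OF U(1) s] W(1-4)])
  qed
  then show ?thesis
    unfolding stalk_map_def by (rule UN_pairs_const[OF germ_self[OF F U(1) s U(2)]])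
qed

lemma linear_stalk_map:
  assumes F: "is_presheaf K X F" and G: "is_presheaf K X G" and \<phi>: "sheaf_hom K X F G \<phi>"
  shows "stalk_map X G x \<phi> \<in> linear_maps K (stalk X F x) (stalk X G x)"
proof (rule linear_mapsI)
  note m = stalk_map_germ[OF F G \<phi>]
  have lin: "\<phi> U \<in> linear_maps K (sec F U) (sec G U)" if "openin X U" for U
    using \<phi> that unfolding sheaf_hom_def by blast
  fix a assume a: "a \<in> carrier (stalk X F x)"
  then obtain U s where U: "openin X U" "x \<in> U" and s: "s \<in> carrier (sec F U)"
    and a': "a = germ X F x U s"
    by (rule stalkE)
  note l = linear_mapsD[OF lin[OF U(1)]]
  show "stalk_map X G x \<phi> a \<in> carrier (stalk X G x)"
    unfolding a' m[OF U s] by (rule germ_in_stalk[OF U l(1)[OF s]])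
  show "stalk_map X G x \<phi> (c \<odot>\<^bsub>stalk X F x\<^esub> a) = c \<odot>\<^bsub>stalk X G x\<^esub> stalk_map X G x \<phi> a"
    if c: "c \<in> carrier K" for c
    unfolding a' stalk_smult[OF F U s c] m[OF U s] stalk_smult[OF G U l(1)[OF s] c]
    using m[OF U module_closed(2)[OF is_presheafD(1)[OF F U(1)] c s]] l(3)[OF c s] by simp
  fix b assume b: "b \<in> carrier (stalk X F x)"
  obtain U s t where U: "openin X U" "x \<in> U" and s: "s \<in> carrier (sec F U)"
    and t: "t \<in> carrier (sec F U)" and e: "a = germ X F x U s" "b = germ X F x U t"
    by (rule stalkE2[OF F a b])
  note l = linear_mapsD[OF lin[OF U(1)]]
  show "stalk_map X G x \<phi> (a \<oplus>\<^bsub>stalk X F x\<^esub> b) =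
      stalk_map X G x \<phi> a \<oplus>\<^bsub>stalk X G x\<^esub> stalk_map X G x \<phi> b"
    unfolding e stalk_add[OF F U s t] m[OF U s] m[OF U t]
      stalk_add[OF G U l(1)[OF s] l(1)[OF t]]
    using m[OF U module_closed(1)[OF is_presheafD(1)[OF F U(1)] s t]] l(2)[OF s t] by simp
qed

text \<open>
  The morphism \<open>\<phi>\<close> joining the two inverse images of \<open>E\<close>.
\<close>

definition homotopy_transport ::
  "'z topology \<Rightarrow> ('x \<times> real \<Rightarrow> 'z) \<Rightarrow> ('k, 'z, 's) presheaf \<Rightarrow>
   'x set \<Rightarrow> ('x \<Rightarrow> ('z set \<times> 's) set) \<Rightarrow> 'x \<Rightarrow> ('z set \<times> 's) set" where
  "homotopy_transport Z H E U s = (\<lambda>y\<in>U. path_transport Z (\<lambda>t. H (y, t)) E (s y))"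

text \<open>
  Linearity and compatibility with restriction hold pointwise; that sections are mapped to sections is
  the continuity of the transport in \<open>y\<close>.
\<close>

lemma homotopy_transport_hom:
  assumes E: "local_system K Z E" and H: "continuous_map (prod_topology X unit_interval) Z H"
    and f: "\<forall>y\<in>topspace X. H (y, 0) = f y" and g: "\<forall>y\<in>topspace X. H (y, 1) = g y"
  shows "sheaf_hom K X (inv_image X Z f E) (inv_image X Z g E) (homotopy_transport Z H E)"
  unfolding sheaf_hom_def
proof (intro conjI allI impI ballI)
  let ?F = "inv_image X Z f E" and ?G = "inv_image X Z g E"
  fix U assume U: "openin X U"
  have UX: "y \<in> topspace X" if "y \<in> U" for y using openin_subset[OF U] that by blast
  have T: "path_transport Z (\<lambda>t. H (y, t)) E \<in> linear_maps K (stalk Z E (f y)) (stalk Z E (g y))"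
    if "y \<in> U" for y
    using linear_path_transport[OF E homotopy_slices(2)[OF H UX[OF that]]] f g UX[OF that] by simp
  show "homotopy_transport Z H E U \<in> linear_maps K (sec ?F U) (sec ?G U)"
  proof (rule linear_mapsI)
    fix s assume s: "s \<in> carrier (sec ?F U)"
    note s_stalk = inv_image_section_stalk[OF s]
    show "homotopy_transport Z H E U s \<in> carrier (sec ?G U)"
    proof (rule inv_image_sectionI[OF U])
      show "homotopy_transport Z H E U s \<in> extensional U" by (simp add: homotopy_transport_def)
      fix x assume x: "x \<in> U"
      obtain W V t where W: "openin X W" "x \<in> W" "W \<subseteq> U" "openin Z V" "f ` W \<subseteq> V"
        "t \<in> carrier (sec E V)" "\<forall>y\<in>W. s y = germ Z E (f y) V t"
        by (rule inv_image_section_near[OF s x])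
      have xV: "H (x, 0) \<in> V" using W(2,5) f UX[OF x] by auto
      obtain W' V' t' where W': "openin X W'" "x \<in> W'" "openin Z V'" "t' \<in> carrier (sec E V')"
        "\<forall>y\<in>W'. H (y, 0) \<in> V \<and> H (y, 1) \<in> V' \<and>
          (\<exists>\<sigma>\<in>path_sections Z (\<lambda>u. H (y, u)) E.
            \<sigma> 0 = germ Z E (H (y, 0)) V t \<and> \<sigma> 1 = germ Z E (H (y, 1)) V' t')"
        by (rule horizontal_continuation[OF E H UX[OF x] W(4) xV W(6)])
      have "g y \<in> V' \<and> homotopy_transport Z H E U s y = germ Z E (g y) V' t'"
        if y: "y \<in> W \<inter> W'" for y
      proof -
        have yU: "y \<in> U" using y W(3) by blast
        obtain \<sigma> where \<sigma>: "\<sigma> \<in> path_sections Z (\<lambda>u. H (y, u)) E"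
          "\<sigma> 0 = germ Z E (H (y, 0)) V t" "\<sigma> 1 = germ Z E (H (y, 1)) V' t'"
          using W'(5) y by blast
        have "\<sigma> 0 = s y" using \<sigma>(2) f UX[OF yU] W(7) y by simp
        then have "path_transport Z (\<lambda>u. H (y, u)) E (s y) = germ Z E (g y) V' t'"
          using path_transport_section[OF E homotopy_slices(2)[OF H UX[OF yU]] \<sigma>(1)]
            \<sigma>(3) g UX[OF yU] by simp
        then show ?thesis using W'(5) y g UX[OF yU] yU by (simp add: homotopy_transport_def) metis
      qed
      then show "\<exists>W V t. openin X W \<and> x \<in> W \<and> openin Z V \<and> t \<in> carrier (sec E V) \<and>
          (\<forall>y\<in>W \<inter> U. g y \<in> V \<and> homotopy_transport Z H E U s y = germ Z E (g y) V t)"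
        using W(1,2) W'(1-4) by (intro exI[of _ "W \<inter> W'"] exI[of _ V'] exI[of _ t']) auto
    qed
    show "homotopy_transport Z H E U (c \<odot>\<^bsub>sec ?F U\<^esub> s) =
        c \<odot>\<^bsub>sec ?G U\<^esub> homotopy_transport Z H E U s" if "c \<in> carrier K" for c
      using linear_mapsD(3)[OF T that s_stalk]
      by (auto simp: homotopy_transport_def intro!: restrict_ext)
    show "homotopy_transport Z H E U (s \<oplus>\<^bsub>sec ?F U\<^esub> t) =
        homotopy_transport Z H E U s \<oplus>\<^bsub>sec ?G U\<^esub> homotopy_transport Z H E U t"
      if "t \<in> carrier (sec ?F U)" for t
      using linear_mapsD(2)[OF T s_stalk inv_image_section_stalk[OF that]]
      by (auto simp: homotopy_transport_def intro!: restrict_ext)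
  qed
next
  fix U V s assume UV: "openin X U \<and> openin X V \<and> V \<subseteq> U"
  then show "homotopy_transport Z H E V (res (inv_image X Z f E) U V s) =
      res (inv_image X Z g E) U V (homotopy_transport Z H E U s)"
    by (auto simp: homotopy_transport_def Int_absorb1 intro!: restrict_ext)
qed

text \<open>
  Under the identifications of stalks, \<open>\<phi>\<close> is at \<open>x\<close> the transport along \<open>t \<mapsto> H (x, t)\<close>.
\<close>

lemma inv_image_stalk_homotopy_transport:
  assumes E: "local_system K Z E" and f: "continuous_map X Z f" and g: "continuous_map X Z g"
    and H: "continuous_map (prod_topology X unit_interval) Z H"
    and Hf: "\<forall>y\<in>topspace X. H (y, 0) = f y" and Hg: "\<forall>y\<in>topspace X. H (y, 1) = g y"
    and a: "a \<in> carrier (stalk X (inv_image X Z f E) x)"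
  shows "inv_image_stalk x (stalk_map X (inv_image X Z g E) x (homotopy_transport Z H E) a) =
    path_transport Z (\<lambda>t. H (x, t)) E (inv_image_stalk x a)"
proof -
  let ?F = "inv_image X Z f E" and ?G = "inv_image X Z g E"
  let ?\<phi> = "homotopy_transport Z H E"
  have P: "is_presheaf K Z E" using E by (simp add: local_system_def is_sheaf_def)
  note F = is_presheaf_inv_image[OF P f] and G = is_presheaf_inv_image[OF P g]
  note \<phi> = homotopy_transport_hom[OF E H Hf Hg]
  obtain U s where U: "openin X U" "x \<in> U" and s: "s \<in> carrier (sec ?F U)" and "a = germ X ?F x U s"
    using a by (rule stalkE)
  have "?\<phi> U s \<in> carrier (sec ?G U)"
    using \<phi> U(1) s linear_mapsD(1) unfolding sheaf_hom_def by metis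
  then have "inv_image_stalk x (germ X ?G x U (?\<phi> U s)) = ?\<phi> U s x"
    by (rule inv_image_stalk_germ[OF P g U])
  then show ?thesis
    using inv_image_stalk_germ[OF P f U s] stalk_map_germ[OF F G \<phi> U s] U(2) \<open>a = _\<close>
    by (simp add: homotopy_transport_def)
qed

lemma tensor_automorphism_natural:
  assumes "tensor_automorphism K R X x \<alpha>" "local_system K X E" "local_system K X F"
    and "sheaf_hom K X E F \<phi>" "a \<in> carrier (fibre K R X x E)"
  shows "\<alpha> F (base_change_map K R (stalk X F x) (stalk_map X F x \<phi>) a) =
    base_change_map K R (stalk X F x) (stalk_map X F x \<phi>) (\<alpha> E a)"
proof -
  have "\<forall>E F \<phi>. local_system K X E \<and> local_system K X F \<and> sheaf_hom K X E F \<phi> \<longrightarrow>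
        (\<forall>a\<in>carrier (fibre K R X x E).
           \<alpha> F (base_change_map K R (stalk X F x) (stalk_map X F x \<phi>) a) =
           base_change_map K R (stalk X F x) (stalk_map X F x \<phi>) (\<alpha> E a))"
    using assms(1)[unfolded tensor_automorphism_def] by (elim conjE) assumption
  then show ?thesis using assms(2-5) by blast
qed

lemma tensor_automorphism_closed:
  assumes "tensor_automorphism K R X x \<alpha>" "local_system K X E" "a \<in> carrier (fibre K R X x E)"
  shows "\<alpha> E a \<in> carrier (fibre K R X x E)"
proof -
  have "\<alpha> E \<in> linear_maps R (fibre K R X x E) (fibre K R X x E)"
    using assms(1)[unfolded tensor_automorphism_def] assms(2) by (elim conjE) blast
  then show ?thesis using assms(3) by (rule linear_mapsD(1))
qed

text \<open>
  The asserted identity at a single local system, by a diagram chase.  Let \<open>d\<close> be the element chosen with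
  \<open>w (c\<^sub>f d) = a\<close>.  The square \<open>w \<circ> c\<^sub>f = c\<^sub>g \<circ> \<phi>\<close> shows that \<open>\<phi> d\<close> is the preimage of \<open>a\<close> under \<open>c\<^sub>g\<close>,
  and the naturality of \<open>\<alpha>\<close> turns \<open>w (c\<^sub>f (\<alpha> d)) = c\<^sub>g (\<phi> (\<alpha> d))\<close> into \<open>c\<^sub>g (\<alpha> (\<phi> d))\<close>.
\<close>

lemma transport_conjugation:
  assumes E: "local_system K Z E" and f: "continuous_map X Z f" and g: "continuous_map X Z g"
    and H: "continuous_map (prod_topology X unit_interval) Z H"
    and Hf: "\<forall>y\<in>topspace X. H (y, 0) = f y" and Hg: "\<forall>y\<in>topspace X. H (y, 1) = g y"
    and x: "x \<in> topspace X" and \<gamma>: "\<forall>t\<in>{0..1}. \<gamma> t = H (x, t)"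
    and \<alpha>: "tensor_automorphism K R X x \<alpha>"
    and c\<^sub>f: "c\<^sub>f = base_change_map K R (stalk Z E (f x)) (inv_image_stalk x)"
    and c\<^sub>g: "c\<^sub>g = base_change_map K R (stalk Z E (g x)) (inv_image_stalk x)"
    and w: "w = base_change_map K R (stalk Z E (g x)) (path_transport Z \<gamma> E)"
    and a: "a \<in> carrier (fibre K R Z (g x) E)"
    and b: "b = inv_into (carrier (fibre K R Z (f x) E)) w a"
  shows "b \<in> carrier (fibre K R Z (f x) E)"
    and "w (c\<^sub>f (\<alpha> (inv_image X Z f E)
        (inv_into (carrier (fibre K R X x (inv_image X Z f E))) c\<^sub>f b))) =
      c\<^sub>g (\<alpha> (inv_image X Z g E) (inv_into (carrier (fibre K R X x (inv_image X Z g E))) c\<^sub>g a))"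
proof -
  let ?F = "inv_image X Z f E" and ?G = "inv_image X Z g E"
  let ?Fx = "stalk X ?F x" and ?Gx = "stalk X ?G x"
  let ?\<phi> = "stalk_map X ?G x (homotopy_transport Z H E)"
  have P: "is_presheaf K Z E" using E by (simp add: local_system_def is_sheaf_def)
  note F = is_presheaf_inv_image[OF P f] and G = is_presheaf_inv_image[OF P g]
  have fx: "f x \<in> topspace Z" and gx: "g x \<in> topspace Z"
    using continuous_map_image_subset_topspace[OF f] continuous_map_image_subset_topspace[OF g] x
    by blast+
  note mods = module_stalk[OF P fx] module_stalk[OF P gx] module_stalk[OF F x] module_stalk[OF G x]
  note \<phi> = homotopy_transport_hom[OF E H Hf Hg]
  note lin_f = linear_inv_image_stalk[OF P f, of x] and lin_g = linear_inv_image_stalk[OF P g, of x]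
  note lin_\<phi> = linear_stalk_map[OF F G \<phi>, of x]
  note bij_f = bij_inv_image_stalk[OF P f x] and bij_g = bij_inv_image_stalk[OF P g x]
  have T: "path_transport Z \<gamma> E = path_transport Z (\<lambda>t. H (x, t)) E"
    by (rule path_transport_cong[OF \<gamma>])
  note path = homotopy_slices(2)[OF H x]
  have lin_T: "path_transport Z \<gamma> E \<in> linear_maps K (stalk Z E (f x)) (stalk Z E (g x))"
    and sur_T: "path_transport Z \<gamma> E ` carrier (stalk Z E (f x)) = carrier (stalk Z E (g x))"
    using linear_path_transport[OF E path] path_transport_surj[OF E path] Hf Hg x
    by (simp_all add: T)
  have lin_comp: "(\<lambda>a. path_transport Z \<gamma> E (inv_image_stalk x a)) \<in>
      linear_maps K ?Fx (stalk Z E (g x))"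
    using linear_mapsD[OF lin_T] linear_mapsD[OF lin_f] by (intro linear_mapsI) auto
  have square: "w (c\<^sub>f d) = c\<^sub>g (base_change_map K R ?Gx ?\<phi> d)"
    if d: "d \<in> carrier (fibre K R X x ?F)" for d
    using base_change_map_comp[OF mods(3,1,2) lin_f lin_T lin_comp HOL.refl d[unfolded fibre_def]]
      base_change_map_comp[OF mods(3,4,2) lin_\<phi> lin_g lin_comp _ d[unfolded fibre_def]]
      inv_image_stalk_homotopy_transport[OF E f g H Hf Hg]
    by (simp add: w c\<^sub>f c\<^sub>g T)
  have sur_w: "w ` carrier (fibre K R Z (f x) E) = carrier (fibre K R Z (g x) E)"
    using base_change_map_surj[OF mods(1,2) lin_T sur_T] by (simp add: fibre_def w)
  then show b': "b \<in> carrier (fibre K R Z (f x) E)"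
    using a unfolding b by (intro inv_into_into) auto
  have wb: "w b = a"
    using sur_w a unfolding b by (intro f_inv_into_f) auto
  define d where "d = inv_into (carrier (fibre K R X x ?F)) c\<^sub>f b"
  have sur_f: "c\<^sub>f ` carrier (fibre K R X x ?F) = carrier (fibre K R Z (f x) E)"
    using base_change_map_surj[OF mods(3,1) lin_f bij_betw_imp_surj_on[OF bij_f]]
    by (simp add: fibre_def c\<^sub>f)
  have d: "d \<in> carrier (fibre K R X x ?F)" "c\<^sub>f d = b"
    using sur_f b' unfolding d_def by (simp_all add: inv_into_into f_inv_into_f)
  let ?d = "base_change_map K R ?Gx ?\<phi> d"
  have "?d \<in> carrier (fibre K R X x ?G)"
    using base_change_map_closed[OF mods(3,4) lin_\<phi>] d(1) by (simp add: fibre_def)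
  moreover have "inj_on c\<^sub>g (carrier (fibre K R X x ?G))"
    using base_change_map_inj[OF mods(4,2) lin_g bij_g] by (simp add: fibre_def c\<^sub>g)
  moreover have "c\<^sub>g ?d = a" using square[OF d(1)] d(2) wb by simp
  ultimately have inv_a: "inv_into (carrier (fibre K R X x ?G)) c\<^sub>g a = ?d"
    by (auto intro: inv_into_f_eq)
  note LF = local_system_inv_image[OF E f] and LG = local_system_inv_image[OF E g]
  have "w (c\<^sub>f (\<alpha> ?F d)) = c\<^sub>g (base_change_map K R ?Gx ?\<phi> (\<alpha> ?F d))"
    by (rule square[OF tensor_automorphism_closed[OF \<alpha> LF d(1)]])
  also have "\<dots> = c\<^sub>g (\<alpha> ?G ?d)"
    using tensor_automorphism_natural[OF \<alpha> LF LG \<phi> d(1)] by simp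
  finally show "w (c\<^sub>f (\<alpha> ?F (inv_into (carrier (fibre K R X x ?F)) c\<^sub>f b))) =
      c\<^sub>g (\<alpha> ?G (inv_into (carrier (fibre K R X x ?G)) c\<^sub>g a))"
    by (simp add: d_def inv_a)
qed

theorem proposition5p1:
  fixes K :: "'k ring" and R :: "('k, 'r) module"
    and X :: "'x topology" and Z :: "'z topology"
    and f g :: "'x \<Rightarrow> 'z" and H :: "'x \<times> real \<Rightarrow> 'z" and x :: 'x and \<gamma> :: "real \<Rightarrow> 'z"
    and \<alpha> :: "('k, 'x, 'x \<Rightarrow> ('z set \<times> 's) set, 'r) fibre_family"
  assumes "field K"
    and "connected_space X" and "connected_space Z"
    and "continuous_map X Z f" and "continuous_map X Z g"
    and "continuous_map (prod_topology X (top_of_set {0..1})) Z H"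
    and "\<forall>y\<in>topspace X. H (y, 0) = f y" and "\<forall>y\<in>topspace X. H (y, 1) = g y"
    and "x \<in> topspace X"
    and "\<forall>t\<in>{0..1}. \<gamma> t = H (x, t)"
    and "Module.algebra K R"
    and "\<alpha> \<in> carrier (pi_k K R X x)"
  shows "pi_k_path K R Z \<gamma> (pi_k_map K R X Z f x \<alpha>) = pi_k_map K R X Z g x \<alpha>"
proof -
  have \<alpha>: "tensor_automorphism K R X x \<alpha>" using assms(12) by (simp add: pi_k_def)
  have ends: "\<gamma> 0 = f x" "\<gamma> 1 = g x" using assms(7-10) by auto
  note step = transport_conjugation[OF _ assms(4-10) \<alpha> HOL.refl HOL.refl HOL.refl _ HOL.refl]
  show ?thesis
    unfolding pi_k_path_def pi_k_map_def Let_def ends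
    using step by (intro restrict_ext) simp
qed

end
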